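(* The sets $\overline{\mathcal G\varphi^{+}},\overline{\mathcal G\varphi^{-}}$ and $\widetilde{\mathcal G\varphi^{+}},\widetilde{\mathcal G\varphi^{-}}$ are forward $f$-invariant (i.e. each such set $S$ satisfies $f(S)\subseteq S$). There are only two possibilities: (A) $\widetilde{\mathcal G\varphi^+}\cap\widetilde{\mathcal G\varphi^-}=\emptyset$, in particular $P=\emptyset$; or (B) $P=C^+\cap C^-$, and this is a dense $G_\delta$-subset of $\mathbb T^2$. In this case, let $\mathcal P$ be the closure in $\mathbb T^2\times I$ of the graph $\{(\theta,\varphi^+(\theta)):\theta\in P\}=\{(\theta,\varphi^-(\theta)):\theta\in P\}$. Then $\mathcal P\subseteq\overline{\mathcal G\varphi^+}\cap\overline{\mathcal G\varphi^-}$, $f(\mathcal P)\subseteq\mathcal P$, and $\pi(\mathcal P)=\mathbb T^2$, where $\pi:\mathbb T^2\times\mathbb R\to\mathbb T^2$ is the canonical projection. If there is any $\nu\in\mathcal E_T(\mathbb T^2)$ with $\lambda^*(\nu)<0$, then case (A) is excluded.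
   Context: Setting. $\mathbb T=\mathbb R/\mathbb Z$, identified as a set with $[0,1)$. Fix $a\in(0,1)$. Let $\tau:\mathbb T\to\mathbb T$, $\tau(\xi)=a^{-1}\xi$ for $\xi\in[0,a)$ and $\tau(\xi)=(1-a)^{-1}(\xi-a)$ for $\xi\in[a,1)$, with $\tau'=a^{-1}$ on $[0,a)$ and $\tau'=(1-a)^{-1}$ on $[a,1)$. The generalized baker map $T:\mathbb T^2\to\mathbb T^2$ is the bijection $T(\xi,x)=(\tau(\xi),ax)$ if $\xi\in[0,a)$ and $T(\xi,x)=(\tau(\xi),a+(1-a)x)$ if $\xi\in[a,1)$. For $x\in\mathbb T$ let $f_x:\mathbb R\to\mathbb R$ be uniformly bounded (in $x$ and $y$) increasing $C^3$ maps with $f_x'>0$ and negative Schwarzian derivative $\mathcal S f_x=\frac{f_x'''}{f_x'}-\frac32\left(\frac{f_x''}{f_x'}\right)^2<0$ (a prime on $f_x$ denotes the derivative in $y$), and let $x\mapsto f_x$ be continuous on $\mathbb T$. Define $f:\mathbb T^2\times\mathbb R\to\mathbb T^2\times\mathbb R$, $f(\xi,x,y)=(T(\xi,x),f_x(y))$; for $\theta=(\xi,x)$ write $f_\theta=f_x$, and define $f_\theta^n$ by $f^n(\theta,y)=(T^n\theta,f_\theta^n(y))$. Assume: there are closed bounded intervals $I\subseteq J\subseteq\mathbb R$ with $I\subseteq J^\circ$, $f(\mathbb T^2\times J)\subseteq\mathbb T^2\times I^\circ$ and $\inf_{(x,y)\in\mathbb T\times J}\tau'(x)\cdot f_{\tau(x)}'(y)>1$;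 and the map $\mathbb T\times J\to\mathbb R$, $(x,y)\mapsto f_x(y)$, is of class $C^2$. Invariant graphs. Let $M>0$ with $|f_\theta(y)|\le M$ for all $(\theta,y)$; $\varphi^+(\theta)=\lim_{k\to\infty}f^k_{T^{-k}\theta}(M)$ and $\varphi^-(\theta)=\lim_{k\to\infty}f^k_{T^{-k}\theta}(-M)$ (monotone pullback limits). These are semi-continuous functions on $\mathbb T^2$, depend on $\theta=(\xi,x)$ only through $x$, and are assumed to take values in $I$. $\mathcal M_T(\mathbb T^2)$ is the set of $T$-invariant Borel probability measures and $\mathcal E_T(\mathbb T^2)$ the set of ergodic ones. For $i\in\{-,*,+\}$, $\lambda^i(\nu)=\int\log f_\theta'(\varphi^i(\theta))\,d\nu(\theta)$. Here $\varphi^*:\mathbb T^2\to\mathbb R$ is a fixed measurable function with $\varphi^-\le\varphi^*\le\varphi^+$ such that for each $\nu\in\mathcal E_T(\mathbb T^2)$ exactly one of the following holds (such $\varphi^*$ is known to exist): (i) $\varphi^-=\varphi^*=\varphi^+$ $\nu$-a.s. and $\lambda^\pm(\nu)\le0$; (ii) $\varphi^-=\varphi^*<\varphi^+$ $\nu$-a.s. and $\lambda^+(\nu)<0=\lambda^-(\nu)$, or $\varphi^-<\varphi^*=\varphi^+$ $\nu$-a.s. and $\lambda^-(\nu)<0=\lambda^+(\nu)$; (iii) $\varphi^-<\varphi^*<\varphi^+$ $\nu$-a.s., $\lambda^\pm(\nu)<0$, $\lambda^*(\nu)>0$ and $\varphi^*$ is $\nu$-a.s. invariant ($f_\theta(\varphi^*(\theta))=\varphi^*(T\theta)$).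 Sets. $\mathcal G\varphi^\pm\subseteq\mathbb T^2\times I$ are the graphs of $\varphi^\pm$, $\overline{\mathcal G\varphi^\pm}$ their closures in $\mathbb T^2\times I$, and the filled-in closures are $\widetilde{\mathcal G\varphi^\pm}=\{(\theta,y)\in\mathbb T^2\times I:\exists y_1,y_2\text{ with }(\theta,y_1),(\theta,y_2)\in\overline{\mathcal G\varphi^\pm},\ y_1\le y\le y_2\}$. $P=\{\theta\in\mathbb T^2:\varphi^+(\theta)=\varphi^-(\theta)\}$ is the set of pinched points. $C^\pm\subseteq\mathbb T^2$ is the set of continuity points of $\varphi^\pm$. *)

theory Defs
  imports "HOL-Probability.Probability"
begin

text \<open>
  The circle \<open>\<real>/\<int>\<close>, identified as a set with \<open>[0,1)\<close> and carrying the quotient metric.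
  The lemma \<open>open_circle_iff\<close> confirms that the topology is the quotient topology,
  so that points close to 1 are close to 0.
\<close>

typedef circle = "{0..<1::real}"
  by (rule exI[of _ 0]) simp

definition to_circle :: "real \<Rightarrow> circle"
  where "to_circle t = Abs_circle (frac t)"

lemma Rep_circle_bounds: "0 \<le> Rep_circle x" "Rep_circle x < 1"
  using Rep_circle[of x] by auto

lemma Rep_to_circle: "Rep_circle (to_circle t) = frac t"
  unfolding to_circle_def by (rule Abs_circle_inverse) (simp add: frac_lt_1)

lemma to_circle_eq_iff: "to_circle s = to_circle t \<longleftrightarrow> frac s = frac t"
  by (metis Rep_to_circle to_circle_def)

lemma to_circle_Rep: "to_circle (Rep_circle x) = x"
  by (metis Rep_circle_bounds Rep_circle_inverse frac_eq to_circle_def)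

instantiation circle :: metric_space
begin

definition dist_circle :: "circle \<Rightarrow> circle \<Rightarrow> real"
  where "dist_circle x y =
    min \<bar>Rep_circle x - Rep_circle y\<bar> (1 - \<bar>Rep_circle x - Rep_circle y\<bar>)"

definition uniformity_circle :: "(circle \<times> circle) filter"
  where "uniformity_circle = (INF e\<in>{0<..}. principal {(x, y). dist x y < e})"

definition open_circle :: "circle set \<Rightarrow> bool"
  where "open_circle U \<longleftrightarrow> (\<forall>x\<in>U. eventually (\<lambda>(x', y). x' = x \<longrightarrow> y \<in> U) uniformity)"

instance
proof
  fix x y z :: circle
  show "dist x y = 0 \<longleftrightarrow> x = y"
    using Rep_circle_bounds[of x] Rep_circle_bounds[of y]
    by (auto simp: dist_circle_def min_def Rep_circle_inject[symmetric])
  show "dist x y \<le> dist x z + dist y z"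
    using Rep_circle_bounds[of x] Rep_circle_bounds[of y] Rep_circle_bounds[of z]
    unfolding dist_circle_def by linarith
qed (simp_all add: uniformity_circle_def open_circle_def)

end

lemma dist_to_circle_le: "dist (to_circle s) (to_circle t) \<le> \<bar>s - t\<bar>"
proof -
  have *: "s = frac s + of_int \<lfloor>s\<rfloor>" "t = frac t + of_int \<lfloor>t\<rfloor>"
    by (simp_all add: frac_def)
  have b: "0 \<le> frac s" "frac s < 1" "0 \<le> frac t" "frac t < 1"
    by (auto simp: frac_lt_1)
  consider "\<lfloor>s\<rfloor> = \<lfloor>t\<rfloor>" | "\<lfloor>s\<rfloor> \<ge> \<lfloor>t\<rfloor> + 1" | "\<lfloor>t\<rfloor> \<ge> \<lfloor>s\<rfloor> + 1" by linarith
  then have "min \<bar>frac s - frac t\<bar> (1 - \<bar>frac s - frac t\<bar>) \<le> \<bar>s - t\<bar>"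
  proof cases
    case 1 then show ?thesis using * by linarith
  next
    case 2 then have "real_of_int \<lfloor>s\<rfloor> \<ge> of_int \<lfloor>t\<rfloor> + 1" by linarith
    then show ?thesis using * b by linarith
  next
    case 3 then have "real_of_int \<lfloor>t\<rfloor> \<ge> of_int \<lfloor>s\<rfloor> + 1" by linarith
    then show ?thesis using * b by linarith
  qed
  then show ?thesis by (simp add: dist_circle_def Rep_to_circle)
qed

lemma open_circle_iff: "open U \<longleftrightarrow> open (to_circle -` U)"
proof
  have "continuous_on UNIV to_circle"
    unfolding continuous_on_iff
    by (metis dist_real_def dist_to_circle_le order_le_less_trans)
  moreover assume "open U"
  ultimately show "open (to_circle -` U)"
    by (metis open_vimage)
next
  assume op: "open (to_circle -` U)"
  show "open U"
    unfolding open_dist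
  proof
    fix p assume "p \<in> U"
    then have "Rep_circle p \<in> to_circle -` U" by (simp add: to_circle_Rep)
    with op obtain e where e: "e > 0" "\<And>t. \<bar>t - Rep_circle p\<bar> < e \<Longrightarrow> to_circle t \<in> U"
      by (auto simp: open_dist dist_real_def)
    have "q \<in> U" if d: "dist q p < e" for q
    proof -
      have "\<exists>k::int. \<bar>(Rep_circle q + of_int k) - Rep_circle p\<bar> < e"
      proof -
        consider "\<bar>Rep_circle q - Rep_circle p\<bar> < e"
          | "\<bar>Rep_circle q + 1 - Rep_circle p\<bar> < e" | "\<bar>Rep_circle q - 1 - Rep_circle p\<bar> < e"
          using d Rep_circle_bounds[of p] Rep_circle_bounds[of q]
          unfolding dist_circle_def by linarith
        then show ?thesis
          by cases (auto intro: exI[of _ 0] exI[of _ 1] exI[of _ "-1"])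
      qed
      then obtain k :: int where k: "\<bar>(Rep_circle q + of_int k) - Rep_circle p\<bar> < e" ..
      have "to_circle (Rep_circle q + of_int k) = q"
        by (metis frac_add_of_int_right to_circle_Rep to_circle_eq_iff)
      with e(2)[OF k] show ?thesis by simp
    qed
    with e(1) show "\<exists>e>0. \<forall>y. dist y p < e \<longrightarrow> y \<in> U" by blast
  qed
qed

definition tau :: "real \<Rightarrow> circle \<Rightarrow> circle"
  where "tau a \<xi> = (if Rep_circle \<xi> < a then to_circle (Rep_circle \<xi> / a)
                    else to_circle ((Rep_circle \<xi> - a) / (1 - a)))"

definition tau' :: "real \<Rightarrow> circle \<Rightarrow> real"
  where "tau' a \<xi> = (if Rep_circle \<xi> < a then 1 / a else 1 / (1 - a))"

definition baker :: "real \<Rightarrow> circle \<times> circle \<Rightarrow> circle \<times> circle"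
  where "baker a = (\<lambda>(\<xi>, x).
    (tau a \<xi>, if Rep_circle \<xi> < a then to_circle (a * Rep_circle x)
              else to_circle (a + (1 - a) * Rep_circle x)))"

definition skew :: "real \<Rightarrow> (circle \<Rightarrow> real \<Rightarrow> real) \<Rightarrow>
    (circle \<times> circle) \<times> real \<Rightarrow> (circle \<times> circle) \<times> real"
  where "skew a f = (\<lambda>(\<theta>, y). (baker a \<theta>, f (snd \<theta>) y))"

definition fibre_iter :: "real \<Rightarrow> (circle \<Rightarrow> real \<Rightarrow> real) \<Rightarrow> nat \<Rightarrow>
    circle \<times> circle \<Rightarrow> real \<Rightarrow> real"
  where "fibre_iter a f n \<theta> y = snd ((skew a f ^^ n) (\<theta>, y))"

text \<open>The upper and lower invariant graphs are the pullback limits started at \<open>M\<close> and \<open>-M\<close>.\<close>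

definition pullback_limit :: "real \<Rightarrow> (circle \<Rightarrow> real \<Rightarrow> real) \<Rightarrow> real \<Rightarrow>
    circle \<times> circle \<Rightarrow> real"
  where "pullback_limit a f c \<theta> = lim (\<lambda>k. fibre_iter a f k ((inv (baker a) ^^ k) \<theta>) c)"

definition C3 :: "(real \<Rightarrow> real) \<Rightarrow> bool"
  where "C3 g \<longleftrightarrow> (\<forall>k<3. \<forall>y. (deriv ^^ k) g differentiable (at y)) \<and>
                  continuous_on UNIV ((deriv ^^ 3) g)"

definition schwarzian :: "(real \<Rightarrow> real) \<Rightarrow> real \<Rightarrow> real"
  where "schwarzian g y =
    (deriv ^^ 3) g y / deriv g y - 3 / 2 * ((deriv ^^ 2) g y / deriv g y)\<^sup>2"

text \<open>
  Derivatives are taken within \<open>S\<close>, hence one-sided at boundary points of \<open>S\<close>. A function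
  on \<open>circle \<times> J\<close> is regarded as of class \<open>C\<^sup>2\<close> if its lift to \<open>\<real> \<times> J\<close>, obtained by
  precomposition with \<open>to_circle\<close>, is.
\<close>

definition C2_on :: "'a::real_normed_vector set \<Rightarrow> ('a \<Rightarrow> 'b::real_normed_vector) \<Rightarrow> bool"
  where "C2_on S g \<longleftrightarrow>
    (\<exists>(g' :: 'a \<Rightarrow> 'a \<Rightarrow>\<^sub>L 'b) (g'' :: 'a \<Rightarrow> 'a \<Rightarrow>\<^sub>L 'a \<Rightarrow>\<^sub>L 'b).
      (\<forall>p\<in>S. (g has_derivative blinfun_apply (g' p)) (at p within S)) \<and>
      (\<forall>p\<in>S. (g' has_derivative blinfun_apply (g'' p)) (at p within S)) \<and>
      continuous_on S g'')"

definition invariant_measures :: "('a::topological_space \<Rightarrow> 'a) \<Rightarrow> 'a measure set"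
  where "invariant_measures T =
    {\<nu>. prob_space \<nu> \<and> sets \<nu> = sets borel \<and>
        T \<in> borel \<rightarrow>\<^sub>M borel \<and> distr \<nu> borel T = \<nu>}"

definition ergodic_measures :: "('a::topological_space \<Rightarrow> 'a) \<Rightarrow> 'a measure set"
  where "ergodic_measures T =
    {\<nu>\<in>invariant_measures T. \<forall>A\<in>sets borel. T -` A = A \<longrightarrow> measure \<nu> A = 0 \<or> measure \<nu> A = 1}"

definition lyapunov :: "(circle \<Rightarrow> real \<Rightarrow> real) \<Rightarrow> (circle \<times> circle \<Rightarrow> real) \<Rightarrow>
    (circle \<times> circle) measure \<Rightarrow> real"
  where "lyapunov f \<phi> \<nu> = (LINT \<theta>|\<nu>. ln (deriv (f (snd \<theta>)) (\<phi> \<theta>)))"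

text \<open>
  In the following, \<open>\<phi>m\<close>, \<open>\<phi>s\<close>, \<open>\<phi>p\<close> stand for
  \<open>\<phi>\<^sup>- \<le> \<phi>\<^sup>* \<le> \<phi>\<^sup>+\<close>.
\<close>

definition alt_one :: "(circle \<Rightarrow> real \<Rightarrow> real) \<Rightarrow> (circle \<times> circle \<Rightarrow> real) \<Rightarrow>
    (circle \<times> circle \<Rightarrow> real) \<Rightarrow> (circle \<times> circle \<Rightarrow> real) \<Rightarrow>
    (circle \<times> circle) measure \<Rightarrow> bool"
  where "alt_one f \<phi>m \<phi>s \<phi>p \<nu> \<longleftrightarrow>
    (AE \<theta> in \<nu>. \<phi>m \<theta> = \<phi>s \<theta> \<and> \<phi>s \<theta> = \<phi>p \<theta>) \<and>
    lyapunov f \<phi>p \<nu> \<le> 0 \<and> lyapunov f \<phi>m \<nu> \<le> 0"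

definition alt_two :: "(circle \<Rightarrow> real \<Rightarrow> real) \<Rightarrow> (circle \<times> circle \<Rightarrow> real) \<Rightarrow>
    (circle \<times> circle \<Rightarrow> real) \<Rightarrow> (circle \<times> circle \<Rightarrow> real) \<Rightarrow>
    (circle \<times> circle) measure \<Rightarrow> bool"
  where "alt_two f \<phi>m \<phi>s \<phi>p \<nu> \<longleftrightarrow>
    ((AE \<theta> in \<nu>. \<phi>m \<theta> = \<phi>s \<theta> \<and> \<phi>s \<theta> < \<phi>p \<theta>) \<and>
      lyapunov f \<phi>p \<nu> < 0 \<and> lyapunov f \<phi>m \<nu> = 0) \<or>
    ((AE \<theta> in \<nu>. \<phi>m \<theta> < \<phi>s \<theta> \<and> \<phi>s \<theta> = \<phi>p \<theta>) \<and>
      lyapunov f \<phi>m \<nu> < 0 \<and> lyapunov f \<phi>p \<nu> = 0)"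

definition alt_three :: "real \<Rightarrow> (circle \<Rightarrow> real \<Rightarrow> real) \<Rightarrow> (circle \<times> circle \<Rightarrow> real) \<Rightarrow>
    (circle \<times> circle \<Rightarrow> real) \<Rightarrow> (circle \<times> circle \<Rightarrow> real) \<Rightarrow>
    (circle \<times> circle) measure \<Rightarrow> bool"
  where "alt_three a f \<phi>m \<phi>s \<phi>p \<nu> \<longleftrightarrow>
    (AE \<theta> in \<nu>. \<phi>m \<theta> < \<phi>s \<theta> \<and> \<phi>s \<theta> < \<phi>p \<theta>) \<and>
    lyapunov f \<phi>p \<nu> < 0 \<and> lyapunov f \<phi>m \<nu> < 0 \<and> lyapunov f \<phi>s \<nu> > 0 \<and>
    (AE \<theta> in \<nu>. f (snd \<theta>) (\<phi>s \<theta>) = \<phi>s (baker a \<theta>))"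

definition exactly_one :: "bool \<Rightarrow> bool \<Rightarrow> bool \<Rightarrow> bool"
  where "exactly_one p q r \<longleftrightarrow>
    (p \<and> \<not> q \<and> \<not> r) \<or> (\<not> p \<and> q \<and> \<not> r) \<or> (\<not> p \<and> \<not> q \<and> r)"

definition graph_over :: "'a set \<Rightarrow> ('a \<Rightarrow> real) \<Rightarrow> ('a \<times> real) set"
  where "graph_over S \<phi> = {(\<theta>, \<phi> \<theta>) | \<theta>. \<theta> \<in> S}"

definition closure_within :: "real set \<Rightarrow> ('a::topological_space \<times> real) set \<Rightarrow> ('a \<times> real) set"
  where "closure_within I S = top_of_set (UNIV \<times> I) closure_of S"

definition graph_closure :: "real set \<Rightarrow> ('a::topological_space \<Rightarrow> real) \<Rightarrow> ('a \<times> real) set"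
  where "graph_closure I \<phi> = closure_within I (graph_over UNIV \<phi>)"

definition filled_closure :: "real set \<Rightarrow> ('a::topological_space \<Rightarrow> real) \<Rightarrow> ('a \<times> real) set"
  where "filled_closure I \<phi> =
    {(\<theta>, y). y \<in> I \<and> (\<exists>y1 y2. (\<theta>, y1) \<in> graph_closure I \<phi> \<and> (\<theta>, y2) \<in> graph_closure I \<phi> \<and>
                              y1 \<le> y \<and> y \<le> y2)}"

definition pinched :: "('a \<Rightarrow> real) \<Rightarrow> ('a \<Rightarrow> real) \<Rightarrow> 'a set"
  where "pinched \<phi>m \<phi>p = {\<theta>. \<phi>p \<theta> = \<phi>m \<theta>}"

definition continuity_points :: "('a::t2_space \<Rightarrow> real) \<Rightarrow> 'a set"
  where "continuity_points \<phi> = {\<theta>. isCont \<phi> \<theta>}"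

end

theory Submission
  imports Defs
begin

text \<open>
  Write \<open>\<phi>\<^sup>+\<close> and \<open>\<phi>\<^sup>-\<close> for the upper and the lower bounding graph. The second coordinate of the
  inverse of the baker map is the expanding circle map \<open>tau\<close>, so both graphs are functions of the
  second coordinate alone, and they satisfy \<open>\<phi>(x') = f\<^sub>x(\<phi>(x))\<close> whenever
  \<open>tau x' = x\<close>. Being monotone limits of continuous functions, \<open>\<phi>\<^sup>+\<close> is upper and \<open>\<phi>\<^sup>-\<close> is lower
  semicontinuous.

  Invariance of the closures. The baker map is discontinuous, but \<open>tau\<close> is an open map of the circle:
  if \<open>x\<^sub>n\<close> converges to \<open>x\<close> and \<open>tau x' = x\<close>, then there are preimages of the \<open>x\<^sub>n\<close>
  that converge to \<open>x'\<close> (\<open>tau_contracting_section\<close>). Approximating sequences can thus be transported along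
  the dynamics (\<open>closure_graph_preimage\<close>), and monotonicity of the fibre maps extends this to the filled-in
  closures.

  Dichotomy. A pinched point lies under a common point of both filled-in closures, so if these are
  disjoint, there are no pinched points. Suppose that they meet. The base points below the
  intersection are closed under \<open>tau\<close>-preimages, and preimages of a point under an
  expanding map are dense (\<open>meeting_points_dense\<close>). On the other hand, every open set contains an open
  set on which both semicontinuous functions are nearly constant and hence their filled-in closures
  are thin; if these also meet there, the gap \<open>\<phi>\<^sup>+ - \<phi>\<^sup>-\<close> is small. So for each \<open>\<epsilon> > 0\<close> the
  open set where the gap is below \<open>\<epsilon>\<close> is dense, and by Baire's theorem the pinched points form a dense
  \<open>G\<^sub>\<delta>\<close> set (\<open>pinched_dense\<close>). At pinched points both functions are continuous by
  semicontinuity; conversely, at a common continuity point the gap vanishes as it does so on a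
  dense set.

  Exponents. If the exponent of \<open>\<phi>\<^sup>*\<close> is negative for an ergodic measure, then only the alternative
  in which the three graphs agree almost surely is left, so there are pinched points.
\<close>

section \<open>The expanding circle map and its inverse branches\<close>

lemma to_circle_add_of_int: "to_circle (t + of_int n) = to_circle t"
  by (simp add: to_circle_eq_iff)

lemma to_circle_diff_2: "to_circle (t - 2) = to_circle t"
  using to_circle_add_of_int[of t "-2"] by simp

lemma compact_UNIV_circle: "compact (UNIV :: circle set)"
proof -
  have "continuous_on {0..1} to_circle"
    unfolding continuous_on_iff by (metis dist_real_def dist_to_circle_le order_le_less_trans)
  then have "compact (to_circle ` {0..1})"
    by (rule compact_continuous_image) simp
  moreover have "x \<in> to_circle ` {0..1}" for x
    using Rep_circle_bounds[of x] by (intro image_eqI[of _ _ "Rep_circle x"]) (auto simp: to_circle_Rep)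
  then have "to_circle ` {0..1} = UNIV"
    by blast
  ultimately show ?thesis
    by simp
qed

text \<open>
  Distances on the circle are realised by distances of representatives. This reduces the
  construction of inverse branches of \<open>tau\<close> to the real line.
\<close>

lemma circle_representative_near:
  obtains u where "to_circle u = z" "\<bar>u - t\<bar> = dist z (to_circle t)"
proof -
  define p where "p = Rep_circle z - frac t"
  have p: "-1 < p" "p < 1"
    using Rep_circle_bounds[of z] frac_ge_0[of t] frac_lt_1[of t] unfolding p_def by linarith+
  have d: "dist z (to_circle t) = min \<bar>p\<bar> (1 - \<bar>p\<bar>)"
    by (simp add: dist_circle_def Rep_to_circle p_def)
  have "\<exists>k::int. \<bar>p + of_int k\<bar> = min \<bar>p\<bar> (1 - \<bar>p\<bar>)"
  proof -
    consider "\<bar>p\<bar> \<le> 1/2" | "p > 1/2" | "p < -1/2" by linarith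
    then show ?thesis
    proof cases
      case 1 then show ?thesis by (intro exI[of _ 0]) auto
    next
      case 2 then show ?thesis using p by (intro exI[of _ "-1"]) auto
    next
      case 3 then show ?thesis using p by (intro exI[of _ 1]) auto
    qed
  qed
  then obtain k :: int where k: "\<bar>p + of_int k\<bar> = min \<bar>p\<bar> (1 - \<bar>p\<bar>)" ..
  show ?thesis
  proof
    show "to_circle (Rep_circle z + of_int (\<lfloor>t\<rfloor> + k)) = z"
      by (simp only: to_circle_add_of_int to_circle_Rep)
    show "\<bar>Rep_circle z + of_int (\<lfloor>t\<rfloor> + k) - t\<bar> = dist z (to_circle t)"
      using k by (simp add: d p_def frac_def algebra_simps)
  qed
qed

text \<open>
  The graph of \<open>tau\<close>, unrolled so that the jump at \<open>a\<close> disappears: an increasing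
  bijection of \<open>[0, 1)\<close> onto \<open>[0, 2)\<close>.
\<close>

definition tau_lift :: "real \<Rightarrow> real \<Rightarrow> real"
  where "tau_lift a s = (if s < a then s / a else 1 + (s - a) / (1 - a))"

lemma tau_eq_tau_lift: "tau a x = to_circle (tau_lift a (Rep_circle x))"
  using to_circle_add_of_int[of "(Rep_circle x - a) / (1 - a)" 1]
  by (simp add: tau_def tau_lift_def add.commute)

lemma tau_to_circle:
  assumes "0 \<le> s" "s < 1"
  shows "tau a (to_circle s) = to_circle (tau_lift a s)"
  using assms by (simp add: tau_eq_tau_lift Rep_to_circle frac_eq)

text \<open>
  The inverse of the unrolled graph, continued to the interval \<open>[-1, 3)\<close> in accordance with
  the degree 2 of \<open>tau\<close>, so that it is also available near the end points of \<open>[0, 2)\<close>.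
  In this sum of clamped linear functions each summand has slope \<open>a\<close> or \<open>1 - a\<close> on one unit
  interval (or half-line) and is constant elsewhere, so that the contraction estimate can be
  proved summand by summand, without a case distinction on the position of the two arguments.
\<close>

definition tau_lift_inv :: "real \<Rightarrow> real \<Rightarrow> real"
  where "tau_lift_inv a u =
    (1 - a) * min 0 u + a * max 0 (min 1 u) + (1 - a) * max 0 (min 1 (u - 1)) + a * max 0 (u - 2)"

lemma tau_lift_inv_pieces:
  "u < 0 \<Longrightarrow> tau_lift_inv a u = (1 - a) * u"
  "0 \<le> u \<Longrightarrow> u < 1 \<Longrightarrow> tau_lift_inv a u = a * u"
  "1 \<le> u \<Longrightarrow> u < 2 \<Longrightarrow> tau_lift_inv a u = a + (1 - a) * (u - 1)"
  "2 \<le> u \<Longrightarrow> tau_lift_inv a u = 1 + a * (u - 2)"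
  by (simp_all add: tau_lift_inv_def)

context
  fixes a :: real
  assumes a: "0 < a" "a < 1"
begin

lemma tau_lift_bounds:
  assumes "0 \<le> s" "s < 1"
  shows "0 \<le> tau_lift a s" "tau_lift a s < 2" "tau_lift_inv a (tau_lift a s) = s"
proof -
  show "0 \<le> tau_lift a s" "tau_lift a s < 2"
    using assms a by (auto simp: tau_lift_def divide_less_eq)
  show "tau_lift_inv a (tau_lift a s) = s"
  proof (cases "s < a")
    case True
    then have "0 \<le> s / a" "s / a < 1"
      using assms a by auto
    then show ?thesis
      using True a by (simp add: tau_lift_def tau_lift_inv_pieces(2))
  next
    case False
    then have "0 \<le> (s - a) / (1 - a)" "(s - a) / (1 - a) < 1"
      using assms a by auto
    then show ?thesis
      using False a by (simp add: tau_lift_def tau_lift_inv_pieces(3))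
  qed
qed

lemma tau_tau_lift_inv:
  assumes "-1 \<le> u" "u < 3"
  shows "tau a (to_circle (tau_lift_inv a u)) = to_circle u"
proof -
  consider "u < 0" | "0 \<le> u" "u < 1" | "1 \<le> u" "u < 2" | "2 \<le> u" by linarith
  then show ?thesis
  proof cases
    case 1
    \<comment> \<open>To the left of 0 the lift takes values close to 1, in the branch of slope \<open>1 / (1 - a)\<close>.\<close>
    have eq: "to_circle ((1 - a) * u) = to_circle (1 + (1 - a) * u)"
      using to_circle_add_of_int[of "(1 - a) * u" 1] by (simp add: add.commute)
    have "(1 - a) * (- 1) \<le> (1 - a) * u"
      using assms a by (intro mult_left_mono) auto
    then have "a - 1 \<le> (1 - a) * u"
      by simp
    moreover have "(1 - a) * u < 0"
      using 1 a by (simp add: mult_pos_neg)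
    ultimately have b: "0 \<le> 1 + (1 - a) * u" "1 + (1 - a) * u < 1" "\<not> 1 + (1 - a) * u < a"
      using a by linarith+
    have "tau_lift a (1 + (1 - a) * u) = u + of_int 2"
      using b a by (simp add: tau_lift_def field_simps)
    then show ?thesis
      using 1 by (simp only: tau_lift_inv_pieces(1) eq tau_to_circle[OF b(1,2)] to_circle_add_of_int)
  next
    case 2
    have "a * u < a * 1"
      using 2 a by (intro mult_strict_left_mono) auto
    then have b: "0 \<le> a * u" "a * u < 1" "a * u < a"
      using 2 a by (simp, linarith, simp)
    have "tau_lift a (a * u) = u"
      using b a by (simp add: tau_lift_def)
    then show ?thesis
      using 2 by (simp add: tau_lift_inv_pieces tau_to_circle[OF b(1,2)])
  next
    case 3
    have "(1 - a) * (u - 1) < 1 - a"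
      using 3 a by simp
    moreover have "0 \<le> (1 - a) * (u - 1)"
      using 3 a by simp
    ultimately have b: "0 \<le> a + (1 - a) * (u - 1)" "a + (1 - a) * (u - 1) < 1" "\<not> a + (1 - a) * (u - 1) < a"
      using a by linarith+
    have "tau_lift a (a + (1 - a) * (u - 1)) = u"
      using b a by (simp add: tau_lift_def)
    then show ?thesis
      using 3 by (simp add: tau_lift_inv_pieces tau_to_circle[OF b(1,2)])
  next
    case 4
    \<comment> \<open>Beyond 2 the lift has turned once and re-enters the branch of slope \<open>1 / a\<close>.\<close>
    have eq: "to_circle (1 + a * (u - 2)) = to_circle (a * (u - 2))"
      using to_circle_add_of_int[of "a * (u - 2)" 1] by (simp add: add.commute)
    have "a * (u - 2) < a"
      using assms a by simp
    then have b: "0 \<le> a * (u - 2)" "a * (u - 2) < 1" "a * (u - 2) < a"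
      using 4 a by (simp, linarith, simp)
    have "tau_lift a (a * (u - 2)) = u - 2"
      using b a by (simp add: tau_lift_def)
    then show ?thesis
      using 4 by (simp add: tau_lift_inv_pieces eq tau_to_circle[OF b(1,2)] to_circle_diff_2)
  qed
qed

lemma tau_lift_inv_slope:
  assumes "u \<le> v"
  shows "0 \<le> tau_lift_inv a v - tau_lift_inv a u"
    and "tau_lift_inv a v - tau_lift_inv a u \<le> max a (1 - a) * (v - u)"
proof -
  let ?r = "max a (1 - a)"
  define d1 where "d1 = min 0 v - min 0 u"
  define d2 where "d2 = max 0 (min 1 v) - max 0 (min 1 u)"
  define d3 where "d3 = max 0 (min 1 (v - 1)) - max 0 (min 1 (u - 1))"
  define d4 where "d4 = max 0 (v - 2) - max 0 (u - 2)"
  have d: "0 \<le> d1" "0 \<le> d2" "0 \<le> d3" "0 \<le> d4"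
    using assms by (auto simp: d1_def d2_def d3_def d4_def)
  have "w = min 0 w + max 0 (min 1 w) + max 0 (min 1 (w - 1)) + max 0 (w - 2)" for w :: real
    by (auto simp: max_def min_def)
  from this[of u] this[of v] have sum: "v - u = d1 + d2 + d3 + d4"
    unfolding d1_def d2_def d3_def d4_def by simp
  have diff: "tau_lift_inv a v - tau_lift_inv a u = (1 - a) * d1 + a * d2 + (1 - a) * d3 + a * d4"
    by (simp add: tau_lift_inv_def d1_def d2_def d3_def d4_def algebra_simps)
  show "0 \<le> tau_lift_inv a v - tau_lift_inv a u"
    using d a unfolding diff by simp
  have "(1 - a) * d1 + a * d2 + (1 - a) * d3 + a * d4 \<le> ?r * d1 + ?r * d2 + ?r * d3 + ?r * d4"
    using d by (intro add_mono mult_right_mono) auto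
  then show "tau_lift_inv a v - tau_lift_inv a u \<le> ?r * (v - u)"
    unfolding diff sum by (simp add: distrib_left)
qed

text \<open>
  The two facts about \<open>tau\<close> that drive the proof are contained here: \<open>tau\<close> is open, i.e. a
  point near \<open>tau a x\<close> has a preimage near \<open>x\<close>, and such preimages can be chosen by a strict
  contraction. Distances on the circle are at most \<open>1/2\<close>, so a representative of \<open>z\<close> can be
  found in \<open>[-1, 3)\<close>, where the inverse of the unrolled graph is available.
\<close>

lemma tau_contracting_section:
  obtains w where "tau a w = z" "dist w x \<le> max a (1 - a) * dist z (tau a x)"
proof -
  define s where "s = Rep_circle x"
  have s: "0 \<le> s" "s < 1" "to_circle s = x"
    using Rep_circle_bounds[of x] by (auto simp: s_def to_circle_Rep)
  define v where "v = tau_lift a s"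
  have v: "0 \<le> v" "v < 2" "tau_lift_inv a v = s"
    using tau_lift_bounds[OF s(1,2)] by (auto simp: v_def)
  have tv: "to_circle v = tau a x"
    by (simp add: tau_eq_tau_lift v_def s_def)
  obtain u where u: "to_circle u = z" "\<bar>u - v\<bar> = dist z (tau a x)"
    using circle_representative_near[of z v] tv by metis
  have "dist z (tau a x) \<le> 1 / 2"
    unfolding dist_circle_def by linarith
  then have "- 1 \<le> u" "u < 3"
    using u(2) v by linarith+
  then have "tau a (to_circle (tau_lift_inv a u)) = z"
    using u(1) by (simp add: tau_tau_lift_inv)
  moreover have "dist (to_circle (tau_lift_inv a u)) x \<le> \<bar>tau_lift_inv a u - tau_lift_inv a v\<bar>"
    using dist_to_circle_le[of "tau_lift_inv a u" s] by (simp add: v s)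
  moreover have "\<bar>tau_lift_inv a u - tau_lift_inv a v\<bar> \<le> max a (1 - a) * \<bar>u - v\<bar>"
    using tau_lift_inv_slope[of u v] tau_lift_inv_slope[of v u] by (cases "u \<le> v") (auto simp: abs_if)
  ultimately show ?thesis
    using that u(2) by fastforce
qed

text \<open>
  Two points with representatives \<open>s \<le> t\<close> are joined by the arc \<open>[s, t]\<close> and by the arc
  through 0. Along the first the unrolled map has slope at most \<open>L\<close>; the second is stretched by at
  most the same factor, because the unrolled map gains exactly 2 in one turn.
\<close>

lemma dist_tau_le: "dist (tau a x) (tau a y) \<le> max (1 / a) (1 / (1 - a)) * dist x y"
proof -
  define L where "L = max (1 / a) (1 / (1 - a))"
  have L_ge: "1 / a \<le> L" "1 / (1 - a) \<le> L"
    by (simp_all add: L_def)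
  have main: "dist (to_circle (tau_lift a s)) (to_circle (tau_lift a t)) \<le> L * min \<bar>s - t\<bar> (1 - \<bar>s - t\<bar>)"
    if st: "0 \<le> s" "s \<le> t" "t < 1" for s t
  proof -
    have L: "p / a \<le> L * p" "p / (1 - a) \<le> L * p" if "p \<ge> 0" for p :: real
      using mult_right_mono[OF L_ge(1) that] mult_right_mono[OF L_ge(2) that] by auto
    have mono_part: "\<bar>tau_lift a s - tau_lift a t\<bar> \<le> L * (t - s)"
    proof (cases "s < a \<and> \<not> t < a")
      case True
      then have *: "tau_lift a t - tau_lift a s = (a - s) / a + (t - a) / (1 - a)"
        using a by (simp add: tau_lift_def field_simps)
      moreover have "(a - s) / a \<le> L * (a - s)" "(t - a) / (1 - a) \<le> L * (t - a)"
        using True by (intro L; simp)+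
      moreover have "0 \<le> (a - s) / a" "0 \<le> (t - a) / (1 - a)"
        using True a by auto
      moreover have "L * (t - s) = L * (a - s) + L * (t - a)"
        by (simp add: algebra_simps)
      ultimately show ?thesis by linarith
    next
      case False
      then have "tau_lift a t - tau_lift a s = (t - s) / a \<or> tau_lift a t - tau_lift a s = (t - s) / (1 - a)"
        using st by (auto simp: tau_lift_def diff_divide_distrib)
      moreover have "0 \<le> (t - s) / a" "0 \<le> (t - s) / (1 - a)"
        using st a by auto
      ultimately show ?thesis
        using L[of "t - s"] st by linarith
    qed
    have "tau_lift a s \<le> L * s"
    proof (cases "s < a")
      case True then show ?thesis using L[of s] st by (simp add: tau_lift_def)
    next
      case False
      have "tau_lift a s = a / a + (s - a) / (1 - a)"
        using False a by (simp add: tau_lift_def)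
      also have "\<dots> \<le> L * a + L * (s - a)"
        using L(1)[of a] L(2)[of "s - a"] False a by (intro add_mono) auto
      finally show ?thesis by (simp add: algebra_simps)
    qed
    moreover have "2 - tau_lift a t \<le> L * (1 - t)"
    proof (cases "t < a")
      case False
      then have "2 - tau_lift a t = (1 - t) / (1 - a)"
        using a by (simp add: tau_lift_def field_simps)
      then show ?thesis using L(2)[of "1 - t"] st by simp
    next
      case True
      have "2 - tau_lift a t = (a - t) / a + (1 - a) / (1 - a)"
        using True a by (simp add: tau_lift_def field_simps)
      also have "\<dots> \<le> L * (a - t) + L * (1 - a)"
        using L(1)[of "a - t"] L(2)[of "1 - a"] True a by (intro add_mono) auto
      finally show ?thesis by (simp add: algebra_simps)
    qed
    moreover have "tau_lift a t < 2" "0 \<le> tau_lift a s"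
      using tau_lift_bounds st by auto
    moreover have "L * (1 - (t - s)) = L * s + L * (1 - t)"
      by (simp add: algebra_simps)
    ultimately have wrap: "\<bar>tau_lift a s - (tau_lift a t - 2)\<bar> \<le> L * (1 - (t - s))"
      by linarith
    have "dist (to_circle (tau_lift a s)) (to_circle (tau_lift a t)) \<le> L * (t - s)"
      using dist_to_circle_le mono_part order_trans by blast
    moreover have "dist (to_circle (tau_lift a s)) (to_circle (tau_lift a t)) \<le> L * (1 - (t - s))"
      using dist_to_circle_le[of "tau_lift a s" "tau_lift a t - 2"] wrap
      unfolding to_circle_diff_2 by linarith
    ultimately show ?thesis
      using st by (auto simp: min_def abs_if)
  qed
  show ?thesis
  proof (cases "Rep_circle x \<le> Rep_circle y")
    case True
    then show ?thesis
      using main[of "Rep_circle x" "Rep_circle y"] Rep_circle_bounds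
      by (simp add: tau_eq_tau_lift dist_circle_def L_def)
  next
    case False
    then show ?thesis
      using main[of "Rep_circle y" "Rep_circle x"] Rep_circle_bounds
      by (subst (1 2) dist_commute) (simp add: tau_eq_tau_lift dist_circle_def L_def)
  qed
qed

lemma continuous_on_tau: "continuous_on UNIV (tau a)"
proof (rule lipschitz_on_continuous_on[OF lipschitz_onI])
  show "dist (tau a x) (tau a y) \<le> max (1 / a) (1 / (1 - a)) * dist x y" for x y
    by (rule dist_tau_le)
  show "0 \<le> max (1 / a) (1 / (1 - a))"
    using a by (simp add: le_max_iff_disj)
qed

text \<open>
  To approach \<open>y\<close> from \<open>Q\<close>, start at a point of \<open>Q\<close>, which has distance at most 1 from
  \<open>tau\<^sup>n y\<close>, and pull it back along the orbit of \<open>y\<close>: each of the \<open>n\<close> steps contracts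
  the distance.
\<close>

lemma tau_preimages_dense:
  assumes "x \<in> Q" "\<And>z w. z \<in> Q \<Longrightarrow> tau a w = z \<Longrightarrow> w \<in> Q"
  shows "closure Q = UNIV"
proof -
  let ?r = "max a (1 - a)"
  have near: "\<exists>w\<in>Q. dist w y \<le> ?r ^ n" for n y
  proof (induction n arbitrary: y)
    case 0
    have "dist x y \<le> 1"
      unfolding dist_circle_def by linarith
    then show ?case using assms(1) by auto
  next
    case (Suc n)
    then obtain z where z: "z \<in> Q" "dist z (tau a y) \<le> ?r ^ n" by blast
    obtain w where w: "tau a w = z" "dist w y \<le> ?r * dist z (tau a y)"
      by (rule tau_contracting_section)
    have "?r * dist z (tau a y) \<le> ?r * ?r ^ n"
      using a z(2) by (intro mult_left_mono) auto
    then show ?case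
      using assms(2)[OF z(1) w(1)] w(2) by (intro bexI[of _ w]) auto
  qed
  have "y \<in> closure Q" for y
    unfolding closure_approachable
  proof (intro allI impI)
    fix e :: real assume "e > 0"
    then obtain n where "?r ^ n < e"
      using real_arch_pow_inv[of e ?r] a by auto
    then show "\<exists>w\<in>Q. dist w y < e"
      using near[of y n] by force
  qed
  then show ?thesis by blast
qed

text \<open>
  The second coordinate of the inverse of the baker map is \<open>tau\<close>. This is why pullback limits
  depend on the second coordinate only, although the baker map itself is discontinuous.
\<close>

lemma tau_baker: "tau a (snd (baker a \<theta>)) = snd \<theta>"
proof -
  obtain \<xi> x where \<theta>: "\<theta> = (\<xi>, x)" by (cases \<theta>)
  let ?s = "Rep_circle x"
  have s: "0 \<le> ?s" "?s < 1" using Rep_circle_bounds by auto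
  show ?thesis
  proof (cases "Rep_circle \<xi> < a")
    case True
    have "tau_lift_inv a ?s = a * ?s"
      using s by (simp add: tau_lift_inv_pieces)
    then show ?thesis
      using True s tau_tau_lift_inv[of ?s] by (simp add: \<theta> baker_def to_circle_Rep)
  next
    case False
    have "tau_lift_inv a (?s + 1) = a + (1 - a) * ?s"
      using s by (simp add: tau_lift_inv_pieces)
    then show ?thesis
      using False s tau_tau_lift_inv[of "?s + 1"] to_circle_add_of_int[of ?s 1]
      by (simp add: \<theta> baker_def to_circle_Rep)
  qed
qed

lemma surj_baker: "surj (baker a)"
proof (rule surjI)
  fix \<theta> :: "circle \<times> circle"
  obtain \<xi> x where \<theta>: "\<theta> = (\<xi>, x)" by (cases \<theta>)
  let ?s = "Rep_circle x" and ?t = "Rep_circle \<xi>"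
  define inv_baker where "inv_baker = (\<lambda>(\<xi>, x).
    (to_circle (if Rep_circle x < a then a * Rep_circle \<xi> else a + (1 - a) * Rep_circle \<xi>), tau a x))"
  have s: "0 \<le> ?s" "?s < 1" "0 \<le> ?t" "?t < 1" using Rep_circle_bounds by auto
  show "baker a (inv_baker \<theta>) = \<theta>"
  proof (cases "?s < a")
    case True
    have b: "a * ?t < a * 1" using a s by (intro mult_strict_left_mono) auto
    then have "a * ?t < 1" using a by linarith
    then have 1: "frac (a * ?t) = a * ?t" using s a by (intro iffD2[OF frac_eq]) auto
    have 2: "frac (?s / a) = ?s / a" using True s a by (intro iffD2[OF frac_eq]) auto
    show ?thesis
      using True a b by (simp add: \<theta> inv_baker_def baker_def tau_def Rep_to_circle 1 2 to_circle_Rep)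
  next
    case False
    have b: "(1 - a) * ?t < (1 - a) * 1" using a s by (intro mult_strict_left_mono) auto
    have c: "0 \<le> (1 - a) * ?t" using a s by simp
    have "a + (1 - a) * ?t < 1" using b by simp
    then have 1: "frac (a + (1 - a) * ?t) = a + (1 - a) * ?t"
      using c a by (intro iffD2[OF frac_eq]) auto
    have 2: "frac ((?s - a) / (1 - a)) = (?s - a) / (1 - a)"
      using False s a by (intro iffD2[OF frac_eq]) auto
    show ?thesis
      using False a c by (simp add: \<theta> inv_baker_def baker_def tau_def Rep_to_circle 1 2 to_circle_Rep)
  qed
qed

end

section \<open>Semicontinuous functions and filled-in closures of graphs\<close>

definition upper_semicont :: "('a::topological_space \<Rightarrow> real) \<Rightarrow> bool"
  where "upper_semicont \<phi> \<longleftrightarrow> (\<forall>c. open {x. \<phi> x < c})"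

lemma upper_semicont_add:
  assumes "upper_semicont \<phi>" "upper_semicont \<psi>"
  shows "upper_semicont (\<lambda>x. \<phi> x + \<psi> x)"
  unfolding upper_semicont_def
proof
  fix c :: real
  have "{x. \<phi> x + \<psi> x < c} = (\<Union>d. {x. \<phi> x < d} \<inter> {x. \<psi> x < c - d})"
  proof (intro set_eqI iffI)
    fix x assume "x \<in> {x. \<phi> x + \<psi> x < c}"
    \<comment> \<open>The separating level is the midpoint of \<open>\<phi> x\<close> and \<open>c - \<psi> x\<close>.\<close>
    then have "\<phi> x < (\<phi> x + (c - \<psi> x)) / 2" "\<psi> x < c - (\<phi> x + (c - \<psi> x)) / 2"
      by (auto simp: field_simps)
    then show "x \<in> (\<Union>d. {x. \<phi> x < d} \<inter> {x. \<psi> x < c - d})" by blast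
  qed auto
  moreover have "open {x. \<phi> x < d}" "open {x. \<psi> x < d}" for d
    using assms by (simp_all add: upper_semicont_def)
  ultimately show "open {x. \<phi> x + \<psi> x < c}"
    by (simp add: open_UN open_Int)
qed

lemma upper_semicont_limit_of_decreasing:
  assumes "\<And>k. continuous_on UNIV (g k)"
    and "\<And>x. decseq (\<lambda>k. g k x)" "\<And>x. (\<lambda>k. g k x) \<longlonglongrightarrow> \<phi> x"
  shows "upper_semicont \<phi>"
  unfolding upper_semicont_def
proof
  fix c :: real
  have "{x. \<phi> x < c} = (\<Union>k. {x. g k x < c})"
  proof (intro set_eqI iffI)
    fix x assume "x \<in> {x. \<phi> x < c}"
    then have "eventually (\<lambda>k. g k x < c) sequentially"
      using order_tendstoD(2)[OF assms(3)[of x]] by simp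
    then show "x \<in> (\<Union>k. {x. g k x < c})"
      by (auto simp: eventually_sequentially)
  next
    fix x assume "x \<in> (\<Union>k. {x. g k x < c})"
    then show "x \<in> {x. \<phi> x < c}"
      using decseq_ge[OF assms(2) assms(3)] le_less_trans by blast
  qed
  moreover have "open {x. g k x < c}" for k
    using assms(1) by (intro open_Collect_less) auto
  ultimately show "open {x. \<phi> x < c}" by auto
qed

text \<open>
  A function that is bounded below almost attains its infimum over \<open>U\<close> at some point, and upper
  semicontinuity keeps it almost as small in a neighbourhood of this point.
\<close>

lemma upper_semicont_nearly_constant:
  assumes "upper_semicont \<phi>" "\<And>x. B \<le> \<phi> x" "open U" "U \<noteq> {}" "\<epsilon> > 0"
  obtains V s where "open V" "V \<noteq> {}" "V \<subseteq> U" "\<And>x. x \<in> V \<Longrightarrow> s \<le> \<phi> x \<and> \<phi> x < s + \<epsilon>"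
proof -
  define s where "s = (INF x\<in>U. \<phi> x)"
  have bdd: "bdd_below (\<phi> ` U)"
    using assms(2) by (auto simp: bdd_below_def)
  have "(INF x\<in>U. \<phi> x) < s + \<epsilon>"
    using \<open>\<epsilon> > 0\<close> by (simp add: s_def)
  then obtain x where x: "x \<in> U" "\<phi> x < s + \<epsilon>"
    using cINF_less_iff[OF \<open>U \<noteq> {}\<close> bdd] by blast
  show ?thesis
  proof
    show "open (U \<inter> {x. \<phi> x < s + \<epsilon>})"
      using assms by (auto simp: upper_semicont_def)
    show "U \<inter> {x. \<phi> x < s + \<epsilon>} \<noteq> {}"
      using x by blast
    show "s \<le> \<phi> x \<and> \<phi> x < s + \<epsilon>" if "x \<in> U \<inter> {x. \<phi> x < s + \<epsilon>}" for x
      using that cINF_lower[OF bdd] by (auto simp: s_def)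
  qed auto
qed

lemma graph_closure_eq:
  assumes "closed I" "\<And>x. x \<in> S \<Longrightarrow> \<phi> x \<in> I"
  shows "closure_within I (graph_over S \<phi>) = closure (graph_over S \<phi>)"
proof -
  have sub: "graph_over S \<phi> \<subseteq> UNIV \<times> I"
    using assms(2) by (auto simp: graph_over_def)
  have "closed (UNIV \<times> I :: ('a \<times> real) set)"
    using assms(1) by (intro closed_Times) auto
  then have "closure (graph_over S \<phi>) \<subseteq> UNIV \<times> I"
    using sub closure_minimal by blast
  moreover have "UNIV \<times> I \<inter> graph_over S \<phi> = graph_over S \<phi>"
    using sub by blast
  ultimately show ?thesis
    by (auto simp: closure_within_def closure_of_subtopology)
qed

lemma graph_closure_bounds:
  assumes "closed I" "\<And>x. \<phi> x \<in> I"
    and "open U" "\<And>x. x \<in> U \<Longrightarrow> s \<le> \<phi> x \<and> \<phi> x \<le> t"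
    and "(x, y) \<in> graph_closure I \<phi>" "x \<in> U"
  shows "s \<le> y \<and> y \<le> t"
proof -
  have "graph_over UNIV \<phi> \<subseteq> (- U) \<times> UNIV \<union> UNIV \<times> {s..t}"
    using assms(4) by (auto simp: graph_over_def)
  moreover have "closed ((- U) \<times> UNIV \<union> UNIV \<times> {s..t})"
    using assms(3) by (intro closed_Un closed_Times) auto
  ultimately have "closure (graph_over UNIV \<phi>) \<subseteq> (- U) \<times> UNIV \<union> UNIV \<times> {s..t}"
    by (rule closure_minimal)
  then show ?thesis
    using assms(5,6) by (auto simp: graph_closure_def graph_closure_eq[OF assms(1,2)])
qed

text \<open>
  Over an open set on which \<open>\<phi>\<close> oscillates little, the filled-in closure is correspondingly thin.
\<close>

lemma filled_closure_bounds:
  assumes "closed I" "\<And>x. \<phi> x \<in> I"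
    and "open U" "\<And>x. x \<in> U \<Longrightarrow> s \<le> \<phi> x \<and> \<phi> x \<le> t"
    and "(x, y) \<in> filled_closure I \<phi>" "x \<in> U"
  shows "s \<le> y \<and> y \<le> t"
  using assms(5) graph_closure_bounds[OF assms(1-4) _ assms(6)]
  by (fastforce simp: filled_closure_def)

lemma graph_point_in_filled_closure:
  assumes "closed I" "\<And>x. \<phi> x \<in> I"
  shows "(x, \<phi> x) \<in> filled_closure I \<phi>"
proof -
  have "(x, \<phi> x) \<in> closure (graph_over UNIV \<phi>)"
    by (rule subsetD[OF closure_subset]) (auto simp: graph_over_def)
  then show ?thesis
    using assms graph_closure_eq[of I UNIV \<phi>]
    by (auto simp: filled_closure_def graph_closure_def)
qed

lemma Baire_compact_UNIV:
  fixes \<G> :: "'a::metric_space set set"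
  assumes "compact (UNIV :: 'a set)" "countable \<G>"
    and "\<And>G. G \<in> \<G> \<Longrightarrow> open G \<and> closure G = UNIV"
  shows "closure (\<Inter>\<G>) = UNIV"
proof -
  have c: "compact_space (euclidean :: 'a topology)"
    using assms(1) by (simp add: compact_space_def)
  have "euclidean closure_of \<Inter>\<G> = topspace (euclidean :: 'a topology)"
    using assms c
    by (intro Baire_category disjI2 conjI compact_imp_locally_compact_space
        compact_Hausdorff_imp_regular_space) auto
  then show ?thesis by simp
qed

context
  fixes \<phi> \<psi> :: "'a::metric_space \<Rightarrow> real" and I :: "real set"
  assumes usc: "upper_semicont \<phi>" and lsc: "upper_semicont (\<lambda>x. - \<psi> x)"
    and le: "\<And>x. \<psi> x \<le> \<phi> x"
begin

lemma open_small_gap: "open {x. \<phi> x - \<psi> x < \<epsilon>}"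
  using upper_semicont_add[OF usc lsc] by (simp add: upper_semicont_def)

text \<open>
  The gap \<open>\<phi> - \<psi>\<close> is upper semicontinuous and nonnegative, which exhibits its zero set as a
  countable intersection of open sets.
\<close>

lemma pinched_eq_Inter: "pinched \<psi> \<phi> = (\<Inter>n. {x. \<phi> x - \<psi> x < 1 / real (Suc n)})"
proof (intro set_eqI iffI)
  fix x assume "x \<in> (\<Inter>n. {x. \<phi> x - \<psi> x < 1 / real (Suc n)})"
  then have "\<phi> x - \<psi> x < inverse (real (Suc n))" for n
    by (simp add: inverse_eq_divide)
  then have "\<not> 0 < \<phi> x - \<psi> x"
    using reals_Archimedean[of "\<phi> x - \<psi> x"] less_asym by blast
  then show "x \<in> pinched \<psi> \<phi>"
    using le[of x] by (simp add: pinched_def)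
qed (simp add: pinched_def)

lemma gdelta_in_pinched: "gdelta_in euclidean (pinched \<psi> \<phi>)"
  unfolding pinched_eq_Inter
  by (rule gdelta_in_Inter) (auto intro!: open_imp_gdelta_in open_small_gap)

text \<open>
  Where the upper semicontinuous \<open>\<phi>\<close> meets the lower semicontinuous \<open>\<psi>\<close> from above, both
  are squeezed: \<open>\<phi>\<close> is bounded below by \<open>\<psi>\<close>, and \<open>\<psi>\<close> is bounded above by \<open>\<phi>\<close>.
\<close>

lemma pinched_subset_continuity_points:
  "pinched \<psi> \<phi> \<subseteq> continuity_points \<phi> \<inter> continuity_points \<psi>"
proof
  fix x assume "x \<in> pinched \<psi> \<phi>"
  then have eq: "\<phi> x = \<psi> x" by (simp add: pinched_def)
  have above: "eventually (\<lambda>y. \<phi> y < c) (at x)" if "\<phi> x < c" for c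
    using usc that unfolding upper_semicont_def eventually_at_topological by blast
  have below: "eventually (\<lambda>y. c < \<psi> y) (at x)" if "c < \<psi> x" for c
  proof -
    have "open {y. - \<psi> y < - c}"
      using lsc unfolding upper_semicont_def by blast
    then show ?thesis
      using that unfolding eventually_at_topological
      by (intro exI[of _ "{y. - \<psi> y < - c}"]) auto
  qed
  have "(\<phi> \<longlongrightarrow> \<phi> x) (at x)"
  proof (rule order_tendstoI)
    show "eventually (\<lambda>y. c < \<phi> y) (at x)" if "c < \<phi> x" for c
      using below[of c] that eq by (auto elim!: eventually_mono intro: less_le_trans[OF _ le])
  qed (rule above)
  moreover have "(\<psi> \<longlongrightarrow> \<psi> x) (at x)"
  proof (rule order_tendstoI)
    show "eventually (\<lambda>y. \<psi> y < c) (at x)" if "\<psi> x < c" for c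
      using above[of c] that eq by (auto elim!: eventually_mono intro: le_less_trans[OF le])
  qed (rule below)
  ultimately show "x \<in> continuity_points \<phi> \<inter> continuity_points \<psi>"
    by (simp add: continuity_points_def isCont_def)
qed

lemma continuity_points_subset_pinched:
  assumes "closure (pinched \<psi> \<phi>) = UNIV"
  shows "continuity_points \<phi> \<inter> continuity_points \<psi> \<subseteq> pinched \<psi> \<phi>"
proof
  fix x assume "x \<in> continuity_points \<phi> \<inter> continuity_points \<psi>"
  then have c: "isCont (\<lambda>y. \<phi> y - \<psi> y) x"
    by (auto simp: continuity_points_def)
  obtain z where z: "\<And>n. z n \<in> pinched \<psi> \<phi>" "z \<longlonglongrightarrow> x"
    using assms closure_sequential[of x "pinched \<psi> \<phi>"] by auto
  have "(\<lambda>n. \<phi> (z n) - \<psi> (z n)) \<longlonglongrightarrow> \<phi> x - \<psi> x"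
    by (rule isCont_tendsto_compose[OF c z(2)])
  moreover have "\<phi> (z n) - \<psi> (z n) = 0" for n
    using z(1)[of n] by (simp add: pinched_def)
  ultimately have "\<phi> x - \<psi> x = 0"
    by (simp add: LIMSEQ_const_iff)
  then show "x \<in> pinched \<psi> \<phi>" by (simp add: pinched_def)
qed

text \<open>
  By Baire's theorem it suffices that the gap is smaller than any given \<open>\<epsilon>\<close> on a dense set. Any open set
  contains a smaller one, \<open>W\<close>, on which both functions oscillate by less than \<open>\<epsilon> / 2\<close>. The
  filled-in closures meet over some point \<open>x\<close> of \<open>W\<close>; as each of them is trapped in a
  strip of height \<open>\<epsilon> / 2\<close> around its graph there, \<open>\<phi> x\<close> and \<open>\<psi> x\<close> differ by less
  than \<open>\<epsilon>\<close>.
\<close>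

lemma pinched_dense:
  assumes "compact (UNIV :: 'a set)"
    and I: "closed I" "bounded I" "\<And>x. \<phi> x \<in> I" "\<And>x. \<psi> x \<in> I"
    and Q: "closure (fst ` (filled_closure I \<phi> \<inter> filled_closure I \<psi>)) = UNIV"
  shows "closure (pinched \<psi> \<phi>) = UNIV"
proof -
  let ?Q = "fst ` (filled_closure I \<phi> \<inter> filled_closure I \<psi>)"
  obtain B where B: "\<And>y. y \<in> I \<Longrightarrow> \<bar>y\<bar> \<le> B"
    using I(2) unfolding bounded_iff by auto
  have dense: "closure {x. \<phi> x - \<psi> x < \<epsilon>} = UNIV" if "\<epsilon> > 0" for \<epsilon>
  proof (rule ccontr)
    define U where "U = - closure {x. \<phi> x - \<psi> x < \<epsilon>}"
    assume "closure {x. \<phi> x - \<psi> x < \<epsilon>} \<noteq> UNIV"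
    then have U: "open U" "U \<noteq> {}" by (auto simp: U_def)
    have lower: "- B \<le> \<phi> x" "- B \<le> - \<psi> x" for x
      using B[OF I(3)[of x]] B[OF I(4)[of x]] by auto
    obtain V s where V: "open V" "V \<noteq> {}" "V \<subseteq> U"
      "\<And>x. x \<in> V \<Longrightarrow> s \<le> \<phi> x \<and> \<phi> x < s + \<epsilon> / 2"
      using upper_semicont_nearly_constant[OF usc lower(1) U, of "\<epsilon> / 2"] \<open>\<epsilon> > 0\<close> by auto
    obtain W t where W: "open W" "W \<noteq> {}" "W \<subseteq> V"
      "\<And>x. x \<in> W \<Longrightarrow> t \<le> - \<psi> x \<and> - \<psi> x < t + \<epsilon> / 2"
      using upper_semicont_nearly_constant[OF lsc lower(2) V(1,2), of "\<epsilon> / 2"] \<open>\<epsilon> > 0\<close> by auto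
    have "W \<inter> ?Q \<noteq> {}"
      using open_Int_closure_eq_empty[OF W(1), of ?Q] W(2) Q by auto
    then obtain x y where xy: "x \<in> W" "(x, y) \<in> filled_closure I \<phi>" "(x, y) \<in> filled_closure I \<psi>"
      by auto
    have "s \<le> y \<and> y \<le> s + \<epsilon> / 2"
      by (rule filled_closure_bounds[OF I(1,3) V(1) _ xy(2)])
        (use V(4) W(3) xy(1) in \<open>auto intro: less_imp_le\<close>)
    moreover have "- t - \<epsilon> / 2 \<le> y \<and> y \<le> - t"
    proof (rule filled_closure_bounds[OF I(1,4) W(1) _ xy(3) xy(1)])
      show "- t - \<epsilon> / 2 \<le> \<psi> z \<and> \<psi> z \<le> - t" if "z \<in> W" for z
        using W(4)[OF that] by linarith
    qed
    moreover have "\<phi> x < s + \<epsilon> / 2" "- \<psi> x < t + \<epsilon> / 2"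
      using V(4) W(3,4) xy(1) by auto
    ultimately have "\<phi> x - \<psi> x < \<epsilon>" by linarith
    then have "x \<in> closure {x. \<phi> x - \<psi> x < \<epsilon>}"
      by (intro subsetD[OF closure_subset]) simp
    then show False
      using xy(1) V(3) W(3) by (auto simp: U_def)
  qed
  show ?thesis
    unfolding pinched_eq_Inter
    by (rule Baire_compact_UNIV[OF assms(1)]) (auto simp: open_small_gap dense)
qed

end

text \<open>
  Above a limit of points of \<open>D\<close>, compactness of the range yields a limit point of the values.
\<close>

lemma fst_closure_graph:
  fixes \<phi> :: "'a::metric_space \<Rightarrow> real"
  assumes "compact I" "\<And>x. x \<in> D \<Longrightarrow> \<phi> x \<in> I" "closure D = UNIV"
  shows "fst ` closure (graph_over D \<phi>) = UNIV"
proof -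
  have "\<exists>y. (x, y) \<in> closure (graph_over D \<phi>)" for x
  proof -
    obtain z where z: "\<And>n. z n \<in> D" "z \<longlonglongrightarrow> x"
      using assms(3) closure_sequential[of x D] by auto
    obtain y r where r: "strict_mono r" "((\<lambda>n. \<phi> (z n)) \<circ> r) \<longlonglongrightarrow> y"
      using seq_compactE[OF compact_imp_seq_compact[OF assms(1)], of "\<lambda>n. \<phi> (z n)"]
        assms(2)[OF z(1)] by metis
    have "(\<lambda>n. (z (r n), \<phi> (z (r n)))) \<longlonglongrightarrow> (x, y)"
      using r(2) LIMSEQ_subseq_LIMSEQ[OF z(2) r(1)] by (intro tendsto_Pair) (auto simp: o_def)
    moreover have "(z (r n), \<phi> (z (r n))) \<in> graph_over D \<phi>" for n
      using z(1) by (auto simp: graph_over_def)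
    ultimately show ?thesis
      using closure_sequential by (metis (no_types, lifting))
  qed
  then show ?thesis by force
qed

section \<open>Pullback limits as invariant graphs\<close>

primrec pullback_iter :: "real \<Rightarrow> (circle \<Rightarrow> real \<Rightarrow> real) \<Rightarrow> nat \<Rightarrow> real \<Rightarrow> circle \<Rightarrow> real"
  where
    "pullback_iter a f 0 c x = c"
  | "pullback_iter a f (Suc k) c x = f (tau a x) (pullback_iter a f k c (tau a x))"

text \<open>
  Invariance of the graph of \<open>\<phi>\<close> under the skew product, together with independence of the
  first coordinate: the points \<open>\<theta>'\<close> range over the image of \<open>\<theta>\<close> under the baker map and over all
  points whose second coordinate is one of the two \<open>tau\<close>-preimages of \<open>snd \<theta>\<close>.
\<close>

definition invariant_graph ::
    "real \<Rightarrow> (circle \<Rightarrow> real \<Rightarrow> real) \<Rightarrow> (circle \<times> circle \<Rightarrow> real) \<Rightarrow> bool"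
  where "invariant_graph a f \<phi> \<longleftrightarrow>
    (\<forall>\<theta> \<theta>'. tau a (snd \<theta>') = snd \<theta> \<longrightarrow> \<phi> \<theta>' = f (snd \<theta>) (\<phi> \<theta>))"

context
  fixes a :: real and f :: "circle \<Rightarrow> real \<Rightarrow> real"
  assumes a: "0 < a" "a < 1"
    and cont: "continuous_on UNIV (\<lambda>(x, y). f x y)"
begin

lemma fibre_iter_pullback:
  "fibre_iter a f k ((inv (baker a) ^^ k) \<theta>) c = pullback_iter a f k c (snd \<theta>)"
proof -
  have inv: "baker a (inv (baker a) \<theta>) = \<theta>" for \<theta>
    by (rule surj_f_inv_f[OF surj_baker[OF a]])
  then have snd_inv: "snd (inv (baker a) \<theta>) = tau a (snd \<theta>)" for \<theta>
    by (metis tau_baker[OF a])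
  have "(skew a f ^^ k) ((inv (baker a) ^^ k) \<theta>, c) = (\<theta>, pullback_iter a f k c (snd \<theta>))"
  proof (induction k arbitrary: \<theta>)
    case (Suc k)
    have "(skew a f ^^ Suc k) ((inv (baker a) ^^ Suc k) \<theta>, c)
        = skew a f ((skew a f ^^ k) ((inv (baker a) ^^ k) (inv (baker a) \<theta>), c))"
      by (subst (2) funpow_Suc_right) simp
    also have "\<dots> = skew a f (inv (baker a) \<theta>, pullback_iter a f k c (tau a (snd \<theta>)))"
      by (simp only: Suc snd_inv)
    also have "\<dots> = (\<theta>, pullback_iter a f (Suc k) c (snd \<theta>))"
      by (simp add: skew_def inv snd_inv)
    finally show ?case .
  qed simp
  then show ?thesis by (simp add: fibre_iter_def)
qed

lemma continuous_on_fibre_map: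
  assumes "continuous_on S g" "continuous_on S h"
  shows "continuous_on S (\<lambda>z. f (g z) (h z))"
  using continuous_on_compose2[OF cont continuous_on_Pair[OF assms]] by simp

lemma continuous_on_pullback_iter: "continuous_on UNIV (pullback_iter a f k c)"
proof (induction k)
  case (Suc k)
  have "continuous_on UNIV (\<lambda>x. pullback_iter a f k c (tau a x))"
    using continuous_on_compose2[OF Suc continuous_on_tau[OF a]] by simp
  then show ?case
    using continuous_on_fibre_map[OF continuous_on_tau[OF a]] by simp
qed simp

lemma invariant_graph_of_limit:
  assumes "\<And>\<theta>. (\<lambda>k. pullback_iter a f k c (snd \<theta>)) \<longlonglongrightarrow> \<phi> \<theta>"
  shows "invariant_graph a f \<phi>"
  unfolding invariant_graph_def
proof (intro allI impI)
  fix \<theta> \<theta>' :: "circle \<times> circle"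
  assume eq: "tau a (snd \<theta>') = snd \<theta>"
  have "continuous_on UNIV (f (snd \<theta>))"
    using continuous_on_fibre_map[OF continuous_on_const continuous_on_id] by simp
  then have "isCont (f (snd \<theta>)) (\<phi> \<theta>)"
    by (simp add: continuous_on_eq_continuous_at)
  then have "(\<lambda>k. f (snd \<theta>) (pullback_iter a f k c (snd \<theta>))) \<longlonglongrightarrow> f (snd \<theta>) (\<phi> \<theta>)"
    using assms[of \<theta>] by (rule isCont_tendsto_compose)
  moreover have "(\<lambda>k. pullback_iter a f (Suc k) c (snd \<theta>')) \<longlonglongrightarrow> \<phi> \<theta>'"
    using assms[of \<theta>'] by (rule LIMSEQ_Suc)
  ultimately show "\<phi> \<theta>' = f (snd \<theta>) (\<phi> \<theta>)"
    by (auto simp: eq intro: LIMSEQ_unique)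
qed

text \<open>
  Although the baker map is discontinuous, closures of invariant graphs are invariant: let
  \<open>(\<theta>\<^sub>n, \<phi> \<theta>\<^sub>n)\<close> approximate \<open>(\<theta>\<^sub>0, y)\<close>. Rather than the images of
  the \<open>\<theta>\<^sub>n\<close>, which may jump, one takes those \<open>tau\<close>-preimages of \<open>snd \<theta>\<^sub>n\<close> that are close
  to \<open>snd \<eta>\<close>; they exist because \<open>tau\<close> is open. Allowing every \<open>\<eta>\<close> over a preimage, and not
  only the image of \<open>\<theta>\<^sub>0\<close> under the baker map, is what yields density below.
\<close>

lemma closure_graph_preimage:
  assumes inv: "invariant_graph a f \<phi>"
    and D: "\<And>\<theta> \<theta>'. \<theta> \<in> D \<Longrightarrow> tau a (snd \<theta>') = snd \<theta> \<Longrightarrow> \<theta>' \<in> D"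
    and mem: "(\<theta>\<^sub>0, y) \<in> closure (graph_over D \<phi>)"
    and eta: "tau a (snd \<eta>) = snd \<theta>\<^sub>0"
  shows "(\<eta>, f (snd \<theta>\<^sub>0) y) \<in> closure (graph_over D \<phi>)"
proof -
  obtain q where q: "\<And>n. q n \<in> graph_over D \<phi>" "q \<longlonglongrightarrow> (\<theta>\<^sub>0, y)"
    using mem closure_sequential by blast
  have "\<exists>\<theta>. \<forall>n. \<theta> n \<in> D \<and> q n = (\<theta> n, \<phi> (\<theta> n))"
    using q(1) by (intro choice) (force simp: graph_over_def)
  then obtain \<theta> where \<theta>: "\<And>n. \<theta> n \<in> D" "\<And>n. q n = (\<theta> n, \<phi> (\<theta> n))"
    by blast
  have "(\<lambda>n. snd (fst (q n))) \<longlonglongrightarrow> snd (fst (\<theta>\<^sub>0, y))" "(\<lambda>n. snd (q n)) \<longlonglongrightarrow> snd (\<theta>\<^sub>0, y)"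
    by (intro tendsto_snd tendsto_fst q(2))+
  then have lim: "(\<lambda>n. snd (\<theta> n)) \<longlonglongrightarrow> snd \<theta>\<^sub>0" "(\<lambda>n. \<phi> (\<theta> n)) \<longlonglongrightarrow> y"
    by (simp_all add: \<theta>(2))
  have "\<exists>w. \<forall>n. tau a (w n) = snd (\<theta> n) \<and>
      dist (w n) (snd \<eta>) \<le> max a (1 - a) * dist (snd (\<theta> n)) (snd \<theta>\<^sub>0)"
  proof (rule choice, rule allI)
    fix n
    show "\<exists>w. tau a w = snd (\<theta> n) \<and>
        dist w (snd \<eta>) \<le> max a (1 - a) * dist (snd (\<theta> n)) (snd \<theta>\<^sub>0)"
      by (rule tau_contracting_section[OF a, of "snd (\<theta> n)" "snd \<eta>"]) (auto simp: eta)
  qed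
  then obtain w where w: "\<And>n. tau a (w n) = snd (\<theta> n)"
      "\<And>n. dist (w n) (snd \<eta>) \<le> max a (1 - a) * dist (snd (\<theta> n)) (snd \<theta>\<^sub>0)"
    by blast
  have "(\<lambda>n. dist (snd (\<theta> n)) (snd \<theta>\<^sub>0)) \<longlonglongrightarrow> 0"
    using lim(1) by (subst (asm) tendsto_dist_iff)
  then have upper: "(\<lambda>n. max a (1 - a) * dist (snd (\<theta> n)) (snd \<theta>\<^sub>0)) \<longlonglongrightarrow> 0"
    by (rule tendsto_mult_right_zero)
  have "(\<lambda>n. dist (w n) (snd \<eta>)) \<longlonglongrightarrow> 0"
    by (rule tendsto_sandwich[OF _ _ tendsto_const upper]) (simp_all add: w(2))
  then have w_lim: "w \<longlonglongrightarrow> snd \<eta>"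
    by (subst tendsto_dist_iff)
  define \<theta>' where "\<theta>' = (\<lambda>n. (fst \<eta>, w n))"
  have snd_\<theta>': "tau a (snd (\<theta>' n)) = snd (\<theta> n)" for n
    by (simp add: \<theta>'_def w(1))
  have \<theta>': "\<theta>' n \<in> D" "\<phi> (\<theta>' n) = f (snd (\<theta> n)) (\<phi> (\<theta> n))" for n
    using D[OF \<theta>(1) snd_\<theta>'] inv snd_\<theta>' unfolding invariant_graph_def by blast+
  have "isCont (\<lambda>(x, y). f x y) (snd \<theta>\<^sub>0, y)"
    using cont by (simp add: continuous_on_eq_continuous_at)
  then have "(\<lambda>n. (\<lambda>(x, y). f x y) (snd (\<theta> n), \<phi> (\<theta> n))) \<longlonglongrightarrow> (\<lambda>(x, y). f x y) (snd \<theta>\<^sub>0, y)"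
    by (rule isCont_tendsto_compose) (intro tendsto_Pair lim)
  then have "(\<lambda>n. \<phi> (\<theta>' n)) \<longlonglongrightarrow> f (snd \<theta>\<^sub>0) y"
    by (simp add: \<theta>'(2))
  moreover have "\<theta>' \<longlonglongrightarrow> (fst \<eta>, snd \<eta>)"
    unfolding \<theta>'_def by (intro tendsto_Pair tendsto_const w_lim)
  ultimately have "(\<lambda>n. (\<theta>' n, \<phi> (\<theta>' n))) \<longlonglongrightarrow> (\<eta>, f (snd \<theta>\<^sub>0) y)"
    by (intro tendsto_Pair) simp_all
  moreover have "\<forall>n. (\<theta>' n, \<phi> (\<theta>' n)) \<in> graph_over D \<phi>"
    using \<theta>'(1) unfolding graph_over_def by blast
  ultimately show ?thesis
    unfolding closure_sequential by (intro exI[of _ "\<lambda>n. (\<theta>' n, \<phi> (\<theta>' n))"] conjI)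
qed

lemma closure_graph_skew_invariant:
  assumes "invariant_graph a f \<phi>"
    and "\<And>\<theta> \<theta>'. \<theta> \<in> D \<Longrightarrow> tau a (snd \<theta>') = snd \<theta> \<Longrightarrow> \<theta>' \<in> D"
  shows "skew a f ` closure (graph_over D \<phi>) \<subseteq> closure (graph_over D \<phi>)"
proof (rule image_subsetI)
  fix p assume p: "p \<in> closure (graph_over D \<phi>)"
  obtain \<theta> y where py: "p = (\<theta>, y)" by (cases p)
  show "skew a f p \<in> closure (graph_over D \<phi>)"
    using closure_graph_preimage[OF assms p[unfolded py] tau_baker[OF a]]
    by (simp add: skew_def py)
qed

text \<open>
  Increasing fibre maps preserve the order between a point and the two closure points that enclose it.
\<close>

lemma filled_closure_preimage:
  assumes I: "closed I" "\<And>\<theta>. \<phi> \<theta> \<in> I"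
    and maps: "\<And>x y. y \<in> I \<Longrightarrow> f x y \<in> I" and incr: "\<And>x. mono (f x)"
    and inv: "invariant_graph a f \<phi>"
    and mem: "(\<theta>, y) \<in> filled_closure I \<phi>"
    and eta: "tau a (snd \<eta>) = snd \<theta>"
  shows "(\<eta>, f (snd \<theta>) y) \<in> filled_closure I \<phi>"
proof -
  obtain y1 y2 where y: "y \<in> I" "(\<theta>, y1) \<in> graph_closure I \<phi>" "(\<theta>, y2) \<in> graph_closure I \<phi>"
      "y1 \<le> y" "y \<le> y2"
    using mem by (auto simp: filled_closure_def)
  have "(\<eta>, f (snd \<theta>) z) \<in> graph_closure I \<phi>" if "(\<theta>, z) \<in> graph_closure I \<phi>" for z
    using closure_graph_preimage[OF inv, of UNIV, OF _ _ eta] that I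
    by (simp add: graph_closure_def graph_closure_eq)
  then have "(\<eta>, f (snd \<theta>) y1) \<in> graph_closure I \<phi>" "(\<eta>, f (snd \<theta>) y2) \<in> graph_closure I \<phi>"
    using y by blast+
  moreover have "f (snd \<theta>) y1 \<le> f (snd \<theta>) y" "f (snd \<theta>) y \<le> f (snd \<theta>) y2"
    using y(4,5) incr by (auto simp: mono_def)
  ultimately show ?thesis
    using maps[OF y(1)] unfolding filled_closure_def by blast
qed

lemma filled_closure_skew_invariant:
  assumes "closed I" "\<And>\<theta>. \<phi> \<theta> \<in> I"
    and "\<And>x y. y \<in> I \<Longrightarrow> f x y \<in> I" and "\<And>x. mono (f x)"
    and "invariant_graph a f \<phi>"
  shows "skew a f ` filled_closure I \<phi> \<subseteq> filled_closure I \<phi>"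
proof (rule image_subsetI)
  fix p assume p: "p \<in> filled_closure I \<phi>"
  obtain \<theta> y where py: "p = (\<theta>, y)" by (cases p)
  show "skew a f p \<in> filled_closure I \<phi>"
    using filled_closure_preimage[OF assms p[unfolded py] tau_baker[OF a]]
    by (simp add: skew_def py)
qed

text \<open>
  The base points over which the filled-in closures meet are closed under passing to
  \<open>tau\<close>-preimages of the second coordinate, with an arbitrary first coordinate.
  One such point therefore spreads over a dense set.
\<close>

lemma meeting_points_dense:
  assumes I: "closed I" "\<And>\<theta>. \<phi> \<theta> \<in> I" "\<And>\<theta>. \<psi> \<theta> \<in> I"
    and maps: "\<And>x y. y \<in> I \<Longrightarrow> f x y \<in> I" and incr: "\<And>x. mono (f x)"
    and inv: "invariant_graph a f \<phi>" "invariant_graph a f \<psi>"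
    and ne: "filled_closure I \<phi> \<inter> filled_closure I \<psi> \<noteq> {}"
  shows "closure (fst ` (filled_closure I \<phi> \<inter> filled_closure I \<psi>)) = UNIV"
proof -
  let ?H = "filled_closure I \<phi> \<inter> filled_closure I \<psi>"
  have preimage: "\<eta> \<in> fst ` ?H" if mem: "\<theta> \<in> fst ` ?H" and eta: "tau a (snd \<eta>) = snd \<theta>" for \<theta> \<eta>
  proof -
    obtain y where "(\<theta>, y) \<in> ?H" using mem by auto
    then have "(\<eta>, f (snd \<theta>) y) \<in> ?H"
      using filled_closure_preimage[OF I(1,2) maps incr inv(1) _ eta]
        filled_closure_preimage[OF I(1,3) maps incr inv(2) _ eta] by blast
    then show ?thesis by force
  qed
  \<comment> \<open>Quantifying over all first coordinates makes the product of the circle with \<open>Q\<close> a subset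
    of the meeting points; one application of the dynamics already produces a point of \<open>Q\<close>.\<close>
  define Q where "Q = {x. \<forall>\<xi>. (\<xi>, x) \<in> fst ` ?H}"
  obtain \<theta> where \<theta>: "\<theta> \<in> fst ` ?H"
    using ne by blast
  have "closure Q = UNIV"
  proof (rule tau_preimages_dense[OF a])
    show "snd (baker a \<theta>) \<in> Q"
      unfolding Q_def using preimage[OF \<theta>] tau_baker[OF a] by simp
    show "w \<in> Q" if "z \<in> Q" "tau a w = z" for z w
      unfolding Q_def
    proof (rule CollectI, rule allI)
      fix \<xi>
      have "(\<xi>, z) \<in> fst ` ?H"
        using \<open>z \<in> Q\<close> by (simp add: Q_def)
      then show "(\<xi>, w) \<in> fst ` ?H"
        by (rule preimage) (simp add: \<open>tau a w = z\<close>)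
    qed
  qed
  then have "closure (UNIV \<times> Q :: (circle \<times> circle) set) = UNIV"
    by (simp add: closure_Times)
  moreover have "UNIV \<times> Q \<subseteq> fst ` ?H"
    by (auto simp: Q_def simp del: fst_image_times)
  ultimately show ?thesis
    using closure_mono by (metis top.extremum_uniqueI)
qed

section \<open>Semicontinuity of the bounding graphs and their exponents\<close>

text \<open>
  All functions involved are pointwise limits of continuous ones: \<open>\<phi>\<close> is the limit of its pullback
  iterates and the derivative is the limit of difference quotients.
\<close>

lemma ln_deriv_measurable:
  fixes \<phi> :: "circle \<times> circle \<Rightarrow> real"
  assumes lim: "\<And>\<theta>. (\<lambda>k. pullback_iter a f k c (snd \<theta>)) \<longlonglongrightarrow> \<phi> \<theta>"
    and diff: "\<And>x y. f x differentiable (at y)"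
  shows "(\<lambda>\<theta>. ln (deriv (f (snd \<theta>)) (\<phi> \<theta>))) \<in> borel_measurable borel"
proof -
  have shifted: "(\<lambda>\<theta>. f (snd \<theta>) (\<phi> \<theta> + h)) \<in> borel_measurable borel" for h
  proof (rule borel_measurable_LIMSEQ_real)
    fix \<theta> :: "circle \<times> circle"
    have "continuous_on UNIV (f (snd \<theta>))"
      using continuous_on_fibre_map[OF continuous_on_const continuous_on_id] by simp
    then have "isCont (f (snd \<theta>)) (\<phi> \<theta> + h)"
      by (simp add: continuous_on_eq_continuous_at)
    then show "(\<lambda>k. f (snd \<theta>) (pullback_iter a f k c (snd \<theta>) + h)) \<longlonglongrightarrow> f (snd \<theta>) (\<phi> \<theta> + h)"
      by (rule isCont_tendsto_compose) (intro tendsto_add lim tendsto_const)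
  next
    fix k
    have "continuous_on UNIV (\<lambda>\<theta>. pullback_iter a f k c (snd \<theta>) + h)"
      by (intro continuous_on_add continuous_on_const
          continuous_on_compose2[OF continuous_on_pullback_iter continuous_on_snd[OF continuous_on_id]]) simp
    then show "(\<lambda>\<theta>. f (snd \<theta>) (pullback_iter a f k c (snd \<theta>) + h)) \<in> borel_measurable borel"
      by (intro borel_measurable_continuous_onI continuous_on_fibre_map continuous_on_snd[OF continuous_on_id])
  qed
  have "(\<lambda>\<theta>. deriv (f (snd \<theta>)) (\<phi> \<theta>)) \<in> borel_measurable borel"
  proof (rule borel_measurable_LIMSEQ_real)
    fix \<theta> :: "circle \<times> circle"
    have "DERIV (f (snd \<theta>)) (\<phi> \<theta>) :> deriv (f (snd \<theta>)) (\<phi> \<theta>)"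
      using diff DERIV_deriv_iff_real_differentiable by blast
    then have "((\<lambda>h. (f (snd \<theta>) (\<phi> \<theta> + h) - f (snd \<theta>) (\<phi> \<theta>)) / h) \<longlongrightarrow> deriv (f (snd \<theta>)) (\<phi> \<theta>)) (at 0)"
      by (simp add: DERIV_def)
    moreover have "filterlim (\<lambda>n. inverse (real (Suc n))) (at 0) sequentially"
      unfolding filterlim_at using LIMSEQ_inverse_real_of_nat by auto
    ultimately show "(\<lambda>n. (f (snd \<theta>) (\<phi> \<theta> + inverse (real (Suc n))) - f (snd \<theta>) (\<phi> \<theta> + 0))
        / inverse (real (Suc n))) \<longlonglongrightarrow> deriv (f (snd \<theta>)) (\<phi> \<theta>)"
      using filterlim_compose by force
  qed (intro borel_measurable_divide borel_measurable_diff shifted borel_measurable_const)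
  then show ?thesis by (rule borel_measurable_ln)
qed

end

context
  fixes a M :: real and f :: "circle \<Rightarrow> real \<Rightarrow> real"
  assumes a: "0 < a" "a < 1" and M: "\<And>x y. \<bar>f x y\<bar> \<le> M"
    and incr: "\<And>x. mono (f x)"
begin

text \<open>
  The constants \<open>M\<close> and \<open>-M\<close> bound all values of the fibre maps, so the first step of the
  iteration moves inwards, and monotone fibre maps propagate this.
\<close>

lemma pullback_iter_from_top_decreasing: "pullback_iter a f (Suc k) M x \<le> pullback_iter a f k M x"
proof (induction k arbitrary: x)
  case 0
  show ?case using M[of "tau a x" M] by simp
next
  case (Suc k)
  show ?case using monoD[OF incr Suc] by simp
qed

lemma pullback_iter_from_bottom_increasing: "pullback_iter a f k (- M) x \<le> pullback_iter a f (Suc k) (- M) x"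
proof (induction k arbitrary: x)
  case 0
  show ?case using M[of "tau a x" "- M"] by simp
next
  case (Suc k)
  show ?case using monoD[OF incr Suc] by simp
qed

lemma abs_pullback_iter_le: "\<bar>c\<bar> \<le> M \<Longrightarrow> \<bar>pullback_iter a f k c x\<bar> \<le> M"
  by (cases k) (simp_all add: M)

lemma M_nonneg: "0 \<le> M"
  using M[of undefined 0] by linarith

lemma decseq_pullback_iter: "decseq (\<lambda>k. pullback_iter a f k M x)"
  by (rule decseq_SucI) (rule pullback_iter_from_top_decreasing)

lemma incseq_pullback_iter: "incseq (\<lambda>k. pullback_iter a f k (- M) x)"
  by (rule incseq_SucI) (rule pullback_iter_from_bottom_increasing)

lemma pullback_limit_LIMSEQ:
  assumes cont: "continuous_on UNIV (\<lambda>(x, y). f x y)" and c: "c = M \<or> c = - M"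
  shows "(\<lambda>k. pullback_iter a f k c (snd \<theta>)) \<longlonglongrightarrow> pullback_limit a f c \<theta>"
proof -
  have "\<bar>c\<bar> \<le> M"
    using c M_nonneg by auto
  then have "Bseq (\<lambda>k. pullback_iter a f k c (snd \<theta>))"
    by (intro BseqI'[of _ M]) (simp add: abs_pullback_iter_le)
  moreover have "monoseq (\<lambda>k. pullback_iter a f k c (snd \<theta>))"
    using c decseq_pullback_iter incseq_pullback_iter by (auto simp: monoseq_iff)
  ultimately have "convergent (\<lambda>k. pullback_iter a f k c (snd \<theta>))"
    by (rule Bseq_monoseq_convergent)
  then show ?thesis
    by (simp add: convergent_LIMSEQ_iff pullback_limit_def fibre_iter_pullback[OF a cont])
qed

lemma upper_semicont_upper_graph:
  assumes cont: "continuous_on UNIV (\<lambda>(x, y). f x y)"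
  shows "upper_semicont (pullback_limit a f M)"
proof (rule upper_semicont_limit_of_decreasing)
  show "continuous_on UNIV (\<lambda>\<theta>. pullback_iter a f k M (snd \<theta>))" for k
    by (rule continuous_on_compose2[OF continuous_on_pullback_iter[OF a cont]
        continuous_on_snd[OF continuous_on_id]]) simp
  show "decseq (\<lambda>k. pullback_iter a f k M (snd \<theta>))" for \<theta> :: "circle \<times> circle"
    by (rule decseq_pullback_iter)
  show "(\<lambda>k. pullback_iter a f k M (snd \<theta>)) \<longlonglongrightarrow> pullback_limit a f M \<theta>" for \<theta>
    by (rule pullback_limit_LIMSEQ[OF cont]) simp
qed

lemma upper_semicont_uminus_lower_graph:
  assumes cont: "continuous_on UNIV (\<lambda>(x, y). f x y)"
  shows "upper_semicont (\<lambda>\<theta>. - pullback_limit a f (- M) \<theta>)"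
proof (rule upper_semicont_limit_of_decreasing)
  show "continuous_on UNIV (\<lambda>\<theta>. - pullback_iter a f k (- M) (snd \<theta>))" for k
    by (rule continuous_on_minus, rule continuous_on_compose2[OF continuous_on_pullback_iter[OF a cont]
        continuous_on_snd[OF continuous_on_id]]) simp
  show "decseq (\<lambda>k. - pullback_iter a f k (- M) (snd \<theta>))" for \<theta> :: "circle \<times> circle"
    using incseq_pullback_iter by (simp add: decseq_def incseq_def)
  show "(\<lambda>k. - pullback_iter a f k (- M) (snd \<theta>)) \<longlonglongrightarrow> - pullback_limit a f (- M) \<theta>" for \<theta>
    by (intro tendsto_minus pullback_limit_LIMSEQ cont) simp
qed

end

text \<open>
  The Bochner integral of a function that is not integrable is 0, so the nonzero exponent of \<open>\<psi>\<close>
  certifies that its integrand is measurable.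
\<close>

lemma lyapunov_AE_cong:
  assumes sets: "sets \<nu> = sets borel"
    and \<phi>: "(\<lambda>\<theta>. ln (deriv (f (snd \<theta>)) (\<phi> \<theta>))) \<in> borel_measurable borel"
    and nz: "lyapunov f \<psi> \<nu> \<noteq> 0"
    and eq: "AE \<theta> in \<nu>. \<psi> \<theta> = \<phi> \<theta>"
  shows "lyapunov f \<psi> \<nu> = lyapunov f \<phi> \<nu>"
proof -
  have "integrable \<nu> (\<lambda>\<theta>. ln (deriv (f (snd \<theta>)) (\<psi> \<theta>)))"
    using nz not_integrable_integral_eq unfolding lyapunov_def by blast
  moreover have "(\<lambda>\<theta>. ln (deriv (f (snd \<theta>)) (\<phi> \<theta>))) \<in> borel_measurable \<nu>"
    using \<phi> by (simp cong: measurable_cong_sets add: measurable_cong_sets[OF sets refl])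
  moreover have "AE \<theta> in \<nu>. ln (deriv (f (snd \<theta>)) (\<psi> \<theta>)) = ln (deriv (f (snd \<theta>)) (\<phi> \<theta>))"
    using eq by eventually_elim simp
  ultimately show ?thesis
    unfolding lyapunov_def by (intro integral_cong_AE) auto
qed

text \<open>
  In the second alternative \<open>\<phi>s\<close> agrees almost surely with the bounding graph of exponent zero, and
  in the third its exponent is positive. A negative exponent leaves only the first alternative, in
  which almost every point is pinched.
\<close>

lemma negative_middle_exponent_imp_pinched:
  assumes \<nu>: "\<nu> \<in> ergodic_measures (baker a)"
    and meas: "(\<lambda>\<theta>. ln (deriv (f (snd \<theta>)) (\<phi>p \<theta>))) \<in> borel_measurable borel"
      "(\<lambda>\<theta>. ln (deriv (f (snd \<theta>)) (\<phi>m \<theta>))) \<in> borel_measurable borel"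
    and neg: "lyapunov f \<phi>s \<nu> < 0"
    and alt: "alt_one f \<phi>m \<phi>s \<phi>p \<nu> \<or> alt_two f \<phi>m \<phi>s \<phi>p \<nu> \<or> alt_three a f \<phi>m \<phi>s \<phi>p \<nu>"
  shows "pinched \<phi>m \<phi>p \<noteq> {}"
proof -
  have \<nu>': "prob_space \<nu>" "sets \<nu> = sets borel"
    using \<nu> by (auto simp: ergodic_measures_def invariant_measures_def)
  have nz: "lyapunov f \<phi>s \<nu> \<noteq> 0"
    using neg by simp
  have "\<not> alt_three a f \<phi>m \<phi>s \<phi>p \<nu>"
    using neg by (auto simp: alt_three_def)
  moreover have "\<not> alt_two f \<phi>m \<phi>s \<phi>p \<nu>"
  proof
    assume "alt_two f \<phi>m \<phi>s \<phi>p \<nu>"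
    then consider "AE \<theta> in \<nu>. \<phi>m \<theta> = \<phi>s \<theta>" "lyapunov f \<phi>m \<nu> = 0"
      | "AE \<theta> in \<nu>. \<phi>s \<theta> = \<phi>p \<theta>" "lyapunov f \<phi>p \<nu> = 0"
      unfolding alt_two_def by auto
    then show False
    proof cases
      case 1
      from 1(1) have "AE \<theta> in \<nu>. \<phi>s \<theta> = \<phi>m \<theta>" by eventually_elim simp
      then show False using lyapunov_AE_cong[OF \<nu>'(2) meas(2) nz] 1(2) nz by simp
    next
      case 2
      then show False using lyapunov_AE_cong[OF \<nu>'(2) meas(1) nz] nz by simp
    qed
  qed
  ultimately have "AE \<theta> in \<nu>. \<phi>m \<theta> = \<phi>s \<theta> \<and> \<phi>s \<theta> = \<phi>p \<theta>"
    using alt by (auto simp: alt_one_def)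
  then have "AE \<theta> in \<nu>. \<theta> \<in> pinched \<phi>m \<phi>p"
    by eventually_elim (simp add: pinched_def)
  then show ?thesis
    using prob_space.AE_False[OF \<nu>'(1)] by auto
qed

section \<open>The dichotomy\<close>

theorem theorem1:
  fixes a M :: real
    and f :: "circle \<Rightarrow> real \<Rightarrow> real"
    and I J :: "real set"
    and \<phi>p \<phi>m \<phi>s :: "circle \<times> circle \<Rightarrow> real"
  assumes a: "0 < a" "a < 1"
    and M: "M > 0" "\<And>x y. \<bar>f x y\<bar> \<le> M"
    and increasing: "\<And>x. mono (f x)"
    and C3: "\<And>x. C3 (f x)"
    and deriv_pos: "\<And>x y. deriv (f x) y > 0"
    and schwarzian: "\<And>x y. schwarzian (f x) y < 0"
    and cont: "continuous_on UNIV (\<lambda>(x, y). f x y)"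
    and I: "is_interval I" "closed I" "bounded I"
    and J: "is_interval J" "closed J" "bounded J"
    and IJ: "I \<subseteq> J" "I \<subseteq> interior J"
    and maps: "skew a f ` (UNIV \<times> J) \<subseteq> UNIV \<times> interior I"
    and hyperbolic: "(INF (x, y)\<in>UNIV \<times> J. tau' a x * deriv (f (tau a x)) y) > 1"
    and C2: "C2_on (UNIV \<times> J) (\<lambda>(t, y). f (to_circle t) y)"
    and phi_plus: "\<phi>p = pullback_limit a f M"
    and phi_minus: "\<phi>m = pullback_limit a f (- M)"
    and range: "\<And>\<theta>. \<phi>p \<theta> \<in> I" "\<And>\<theta>. \<phi>m \<theta> \<in> I"
    and phi_star: "\<phi>s \<in> borel_measurable borel" "\<And>\<theta>. \<phi>m \<theta> \<le> \<phi>s \<theta>" "\<And>\<theta>. \<phi>s \<theta> \<le> \<phi>p \<theta>"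
    and alternatives: "\<And>\<nu>. \<nu> \<in> ergodic_measures (baker a) \<Longrightarrow>
      exactly_one (alt_one f \<phi>m \<phi>s \<phi>p \<nu>) (alt_two f \<phi>m \<phi>s \<phi>p \<nu>) (alt_three a f \<phi>m \<phi>s \<phi>p \<nu>)"
  shows "(\<forall>S\<in>{graph_closure I \<phi>p, graph_closure I \<phi>m, filled_closure I \<phi>p, filled_closure I \<phi>m}.
            skew a f ` S \<subseteq> S) \<and>
    ((filled_closure I \<phi>p \<inter> filled_closure I \<phi>m = {} \<and> pinched \<phi>m \<phi>p = {}) \<or>
     (pinched \<phi>m \<phi>p = continuity_points \<phi>p \<inter> continuity_points \<phi>m \<and>
      closure (pinched \<phi>m \<phi>p) = UNIV \<and>
      gdelta_in euclidean (pinched \<phi>m \<phi>p) \<and>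
      graph_over (pinched \<phi>m \<phi>p) \<phi>p = graph_over (pinched \<phi>m \<phi>p) \<phi>m \<and>
      (let P = closure_within I (graph_over (pinched \<phi>m \<phi>p) \<phi>p) in
         P \<subseteq> graph_closure I \<phi>p \<inter> graph_closure I \<phi>m \<and>
         skew a f ` P \<subseteq> P \<and>
         fst ` P = UNIV))) \<and>
    ((\<exists>\<nu>\<in>ergodic_measures (baker a). lyapunov f \<phi>s \<nu> < 0) \<longrightarrow>
       filled_closure I \<phi>p \<inter> filled_closure I \<phi>m \<noteq> {})"
proof -
  have I_cpt: "compact I"
    using I by (simp add: compact_eq_bounded_closed)
  have I_maps: "f x y \<in> I" if "y \<in> I" for x y
  proof -
    have "skew a f ((undefined, x), y) \<in> UNIV \<times> interior I"
      using maps IJ that by blast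
    then show ?thesis
      using interior_subset by (auto simp: skew_def)
  qed
  have lim_p: "(\<lambda>k. pullback_iter a f k M (snd \<theta>)) \<longlonglongrightarrow> \<phi>p \<theta>"
    and lim_m: "(\<lambda>k. pullback_iter a f k (- M) (snd \<theta>)) \<longlonglongrightarrow> \<phi>m \<theta>" for \<theta>
    unfolding phi_plus phi_minus
    by (intro pullback_limit_LIMSEQ[OF a M(2) increasing cont]; simp)+
  have inv: "invariant_graph a f \<phi>p" "invariant_graph a f \<phi>m"
    using invariant_graph_of_limit[OF a cont] lim_p lim_m by blast+
  have usc: "upper_semicont \<phi>p"
    unfolding phi_plus by (rule upper_semicont_upper_graph[OF a M(2) increasing cont])
  have lsc: "upper_semicont (\<lambda>\<theta>. - \<phi>m \<theta>)"
    unfolding phi_minus by (rule upper_semicont_uminus_lower_graph[OF a M(2) increasing cont])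
  have le: "\<phi>m \<theta> \<le> \<phi>p \<theta>" for \<theta>
    using phi_star(2,3) order_trans by blast
  let ?P = "pinched \<phi>m \<phi>p"
  let ?H = "filled_closure I \<phi>p \<inter> filled_closure I \<phi>m"
  have P_imp_H: "?H \<noteq> {}" if ne: "?P \<noteq> {}"
  proof -
    obtain \<theta> where "\<phi>p \<theta> = \<phi>m \<theta>"
      using ne unfolding pinched_def by blast
    then have "(\<theta>, \<phi>p \<theta>) \<in> ?H"
      using graph_point_in_filled_closure[OF I(2), of \<phi>p \<theta>] graph_point_in_filled_closure[OF I(2), of \<phi>m \<theta>]
        range by simp
    then show ?thesis by blast
  qed
  have P_back: "\<theta>' \<in> ?P" if "\<theta> \<in> ?P" "tau a (snd \<theta>') = snd \<theta>" for \<theta> \<theta>'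
  proof -
    have "\<phi>p \<theta>' = f (snd \<theta>) (\<phi>p \<theta>)" "\<phi>m \<theta>' = f (snd \<theta>) (\<phi>m \<theta>)"
      using inv that(2) unfolding invariant_graph_def by blast+
    then show ?thesis
      using that(1) by (simp add: pinched_def)
  qed
  have closures: "skew a f ` S \<subseteq> S"
    if S: "S \<in> {graph_closure I \<phi>p, graph_closure I \<phi>m, filled_closure I \<phi>p, filled_closure I \<phi>m}" for S
  proof -
    have "skew a f ` graph_closure I \<phi> \<subseteq> graph_closure I \<phi>"
      if "invariant_graph a f \<phi>" "\<And>\<theta>. \<phi> \<theta> \<in> I" for \<phi>
      using closure_graph_skew_invariant[OF a cont that(1), of UNIV] that(2)
      by (simp add: graph_closure_def graph_closure_eq I(2))
    moreover have "skew a f ` filled_closure I \<phi> \<subseteq> filled_closure I \<phi>"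
      if "invariant_graph a f \<phi>" "\<And>\<theta>. \<phi> \<theta> \<in> I" for \<phi>
      using filled_closure_skew_invariant[OF a cont I(2) that(2) I_maps increasing that(1)] .
    ultimately have "skew a f ` graph_closure I \<phi>p \<subseteq> graph_closure I \<phi>p"
      "skew a f ` graph_closure I \<phi>m \<subseteq> graph_closure I \<phi>m"
      "skew a f ` filled_closure I \<phi>p \<subseteq> filled_closure I \<phi>p"
      "skew a f ` filled_closure I \<phi>m \<subseteq> filled_closure I \<phi>m"
      using inv range by simp_all
    then show ?thesis
      using S by (elim insertE emptyE) simp_all
  qed
  have possibility_B: "?P = continuity_points \<phi>p \<inter> continuity_points \<phi>m \<and>
      closure ?P = UNIV \<and> gdelta_in euclidean ?P \<and>
      graph_over ?P \<phi>p = graph_over ?P \<phi>m \<and>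
      (let P = closure_within I (graph_over ?P \<phi>p) in
         P \<subseteq> graph_closure I \<phi>p \<inter> graph_closure I \<phi>m \<and> skew a f ` P \<subseteq> P \<and> fst ` P = UNIV)"
    if "?H \<noteq> {}"
  proof -
    have cpt: "compact (UNIV :: (circle \<times> circle) set)"
      using compact_Times[OF compact_UNIV_circle compact_UNIV_circle] by simp
    have dense: "closure ?P = UNIV"
      by (rule pinched_dense[OF usc lsc le cpt I(2,3) range
            meeting_points_dense[OF a cont I(2) range I_maps increasing inv that]])
    have graphs: "graph_over ?P \<phi>p = graph_over ?P \<phi>m"
      by (auto simp: graph_over_def pinched_def)
    have P_eq: "closure_within I (graph_over ?P \<phi>p) = closure (graph_over ?P \<phi>p)"
      by (rule graph_closure_eq) (simp_all add: I(2) range)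
    have "closure (graph_over ?P \<phi>) \<subseteq> graph_closure I \<phi>" if "\<And>\<theta>. \<phi> \<theta> \<in> I" for \<phi>
    proof -
      have "graph_over ?P \<phi> \<subseteq> graph_over UNIV \<phi>"
        by (auto simp: graph_over_def)
      then show ?thesis
        using that by (simp add: graph_closure_def graph_closure_eq I(2) closure_mono)
    qed
    then have "closure (graph_over ?P \<phi>p) \<subseteq> graph_closure I \<phi>p \<inter> graph_closure I \<phi>m"
      using range graphs by (metis Int_greatest)
    moreover have "skew a f ` closure (graph_over ?P \<phi>p) \<subseteq> closure (graph_over ?P \<phi>p)"
      by (rule closure_graph_skew_invariant[OF a cont inv(1) P_back])
    moreover have "fst ` closure (graph_over ?P \<phi>p) = UNIV"
      by (rule fst_closure_graph[OF I_cpt range(1) dense])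
    moreover have "?P = continuity_points \<phi>p \<inter> continuity_points \<phi>m"
      using pinched_subset_continuity_points[OF usc lsc le]
        continuity_points_subset_pinched[OF usc lsc le dense] by (rule equalityI)
    ultimately show ?thesis
      unfolding P_eq Let_def using dense graphs gdelta_in_pinched[OF usc lsc le] by blast
  qed
  have diff: "f x differentiable (at y)" for x y
    using C3[of x] unfolding C3_def by (metis funpow_0 zero_less_numeral)
  have excluded: "?H \<noteq> {}" if "\<nu> \<in> ergodic_measures (baker a)" "lyapunov f \<phi>s \<nu> < 0" for \<nu>
  proof (rule P_imp_H, rule negative_middle_exponent_imp_pinched[OF that(1) _ _ that(2)])
    show "(\<lambda>\<theta>. ln (deriv (f (snd \<theta>)) (\<phi>p \<theta>))) \<in> borel_measurable borel"
      by (rule ln_deriv_measurable[OF a cont lim_p diff])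
    show "(\<lambda>\<theta>. ln (deriv (f (snd \<theta>)) (\<phi>m \<theta>))) \<in> borel_measurable borel"
      by (rule ln_deriv_measurable[OF a cont lim_m diff])
    show "alt_one f \<phi>m \<phi>s \<phi>p \<nu> \<or> alt_two f \<phi>m \<phi>s \<phi>p \<nu> \<or> alt_three a f \<phi>m \<phi>s \<phi>p \<nu>"
      using alternatives[OF that(1)] by (auto simp: exactly_one_def)
  qed
  show ?thesis
  proof (intro conjI)
    show "\<forall>S\<in>{graph_closure I \<phi>p, graph_closure I \<phi>m, filled_closure I \<phi>p, filled_closure I \<phi>m}.
        skew a f ` S \<subseteq> S"
      using closures by blast
  next
    show "(\<exists>\<nu>\<in>ergodic_measures (baker a). lyapunov f \<phi>s \<nu> < 0) \<longrightarrow> ?H \<noteq> {}"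
      using excluded by blast
  qed (use possibility_B P_imp_H in blast)
qed

end
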